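(* Let $\boldsymbol f$ be a global (defined for all $t\ge0$) solution of the area-preserving curvature flow $$\partial_t\boldsymbol f=\tilde\kappa\,\boldsymbol\nu$$ of closed plane curves, such that the initial rotation number is $1$. Then the curve converges to a circle exponentially as $t\to\infty$ in the sense that, for all $t\ge0$, $$0\le L(t)^2-4\pi A(t)\le\left(L(0)^2-4\pi A(0)\right)\exp\left(-\frac{16\pi^2}{L(0)^2}t\right),$$ $$\left|L(t)-2\sqrt{\pi A(0)}\right|\le\frac{L(0)^2-4\pi A(0)}{4\sqrt{\pi A(0)}}\exp\left(-\frac{16\pi^2}{L(0)^2}t\right).$$
   Context: For a closed plane curve of length $L$ with arc-length parametrization $\boldsymbol f=(f_1,f_2):\mathbb R/L\mathbb Z\to\mathbb R^2$, let $\boldsymbol\nu=(-\partial_sf_2,\partial_sf_1)$ be the unit normal, $\boldsymbol\kappa=\partial_s^2\boldsymbol f$ the curvature vector, $\kappa=\boldsymbol\kappa\cdot\boldsymbol\nu$ the curvature, $\tilde\kappa=\kappa-\frac1L\int_0^L\kappa\,ds$ (which equals $\kappa-\frac{2\pi}{L}$ for rotation number $1$), and $A=-\frac12\int_0^L\boldsymbol f\cdot\boldsymbol\nu\,ds$ the signed area. Rotation number $1$ means $\int_0^L\kappa\,ds=2\pi$. Curves need not be simple or convex. A global solution of the flow is a smooth family of immersed closed curves $F:\mathbb R/\mathbb Z\times[0,\infty)\to\mathbb R^2$ such that, at each fixed parameter $p\in\mathbb R/\mathbb Z$, $\partial_tF(p,t)=\tilde\kappa\,\boldsymbol\nu$ evaluated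 at the point $F(p,t)$ of the curve $F(\cdot,t)$; $\boldsymbol f(\cdot,t):\mathbb R/L(t)\mathbb Z\to\mathbb R^2$ is the arc-length parametrization of $F(\cdot,t)$, and $L(t),A(t)$ are the length and signed area of the curve at time $t$. *)

theory Defs
  imports "HOL-Analysis.Analysis"
begin

text \<open>
  Smoothness on a set, with all derivatives taken within the set, so that on a set such as
  the closed half-plane \<open>{0..} \<times> UNIV\<close> smoothness up to the boundary is meant. The derivative
  within a set is unique only if the set is thick enough (e.g. convex with nonempty interior),
  and the notion is only used for such sets.
\<close>

primrec Ck_on :: "nat \<Rightarrow> 'a::euclidean_space set \<Rightarrow> ('a \<Rightarrow> 'b::real_normed_vector) \<Rightarrow> bool" where
  "Ck_on 0 S f \<longleftrightarrow> continuous_on S f"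
| "Ck_on (Suc k) S f \<longleftrightarrow>
     (\<exists>f'. (\<forall>x\<in>S. (f has_derivative f' x) (at x within S)) \<and> (\<forall>v. Ck_on k S (\<lambda>x. f' x v)))"

definition smooth_on :: "'a::euclidean_space set \<Rightarrow> ('a \<Rightarrow> 'b::real_normed_vector) \<Rightarrow> bool" where
  "smooth_on S f \<longleftrightarrow> (\<forall>k. Ck_on k S f)"

text \<open>
  A closed curve \<open>\<real>/\<int> \<rightarrow> \<real>\<^sup>2\<close> is a function on \<open>\<real>\<close> of period \<open>1\<close>; smoothness is required
  separately, jointly with the time variable.
\<close>

definition immersed_closed :: "(real \<Rightarrow> real^2) \<Rightarrow> bool" where
  "immersed_closed c \<longleftrightarrow>
     (\<forall>p. c (p + 1) = c p) \<and> (\<forall>p. vector_derivative c (at p) \<noteq> 0)"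

definition curve_length :: "(real \<Rightarrow> real^2) \<Rightarrow> real" where
  "curve_length c = integral {0..1} (\<lambda>p. norm (vector_derivative c (at p)))"

text \<open>
  The signed arc length from parameter \<open>0\<close> to \<open>p\<close>. For a smooth immersed closed curve it is a
  bijection of \<open>\<real>\<close>, and its inverse yields the arc-length parametrization as a function on \<open>\<real>\<close>
  of period \<open>curve_length c\<close>.
\<close>

definition arclength :: "(real \<Rightarrow> real^2) \<Rightarrow> real \<Rightarrow> real" where
  "arclength c p =
     (if 0 \<le> p then integral {0..p} (\<lambda>q. norm (vector_derivative c (at q)))
      else - integral {p..0} (\<lambda>q. norm (vector_derivative c (at q))))"

definition arclength_param :: "(real \<Rightarrow> real^2) \<Rightarrow> real \<Rightarrow> real^2" where
  "arclength_param c s = c (inv (arclength c) s)"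

text \<open>
  The following quantities are functions of the arc-length parameter \<open>s\<close>, not of the parameter
  \<open>p\<close> of \<open>c\<close>. A counterclockwise circle has inward normal, positive curvature and positive area.
\<close>

definition unit_normal :: "(real \<Rightarrow> real^2) \<Rightarrow> real \<Rightarrow> real^2" where
  "unit_normal c s =
     (let \<tau> = vector_derivative (arclength_param c) (at s) in vector [- (\<tau> $ 2), \<tau> $ 1])"

definition curvature_vector :: "(real \<Rightarrow> real^2) \<Rightarrow> real \<Rightarrow> real^2" where
  "curvature_vector c s =
     vector_derivative (\<lambda>r. vector_derivative (arclength_param c) (at r)) (at s)"

definition curvature :: "(real \<Rightarrow> real^2) \<Rightarrow> real \<Rightarrow> real" where
  "curvature c s = curvature_vector c s \<bullet> unit_normal c s"

definition curvature_deviation :: "(real \<Rightarrow> real^2) \<Rightarrow> real \<Rightarrow> real" where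
  "curvature_deviation c s =
     curvature c s - 1 / curve_length c * integral {0..curve_length c} (curvature c)"

definition rotation_number :: "(real \<Rightarrow> real^2) \<Rightarrow> real" where
  "rotation_number c = 1 / (2 * pi) * integral {0..curve_length c} (curvature c)"

definition signed_area :: "(real \<Rightarrow> real^2) \<Rightarrow> real" where
  "signed_area c =
     - (1 / 2) * integral {0..curve_length c} (\<lambda>s. arclength_param c s \<bullet> unit_normal c s)"

text \<open>
  The time variable comes first: \<open>F t\<close> is the curve at time \<open>t\<close>. Only the values \<open>F t\<close> with
  \<open>t \<ge> 0\<close> are relevant; the time derivative at \<open>t = 0\<close> is one-sided.
\<close>

definition global_area_preserving_flow :: "(real \<Rightarrow> real \<Rightarrow> real^2) \<Rightarrow> bool" where
  "global_area_preserving_flow F \<longleftrightarrow>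
     smooth_on ({0..} \<times> UNIV) (\<lambda>(t, p). F t p) \<and>
     (\<forall>t\<ge>0. immersed_closed (F t)) \<and>
     (\<forall>t\<ge>0. \<forall>p. ((\<lambda>t'. F t' p) has_vector_derivative
        curvature_deviation (F t) (arclength (F t) p) *\<^sub>R unit_normal (F t) (arclength (F t) p))
        (at t within {0..}))"

end

theory Submission
  imports Defs
begin

text \<open>
  Write \<open>D = L\<^sup>2 - 4 \<pi> A\<close> for the isoperimetric deficit and \<open>\<kappa>~\<close> for the deviation of the curvature
  from its mean. The first variation formulas give \<open>A' = - \<integral> \<kappa>~ ds = 0\<close> and
  \<open>L' = - \<integral> \<kappa> \<kappa>~ ds = - \<integral> \<kappa>~\<^sup>2 ds\<close>, hence \<open>D' = - 2 L \<integral> \<kappa>~\<^sup>2 ds\<close>. Everything rests on the inequality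
  \<open>8 \<pi>\<^sup>2 D \<le> L\<^sup>3 \<integral> \<kappa>~\<^sup>2 ds\<close> for closed curves of rotation number one
  (\<open>isoperimetric_deficit_bounds\<close>), which turns this into \<open>D' \<le> - 16 \<pi>\<^sup>2 D / L\<^sup>2\<close>. The length
  decreases and \<open>D \<ge> 0\<close> by the isoperimetric inequality, so \<open>L\<close> may be replaced by its initial value
  and \<open>D\<close> decays exponentially. The rotation number has to stay one along the flow
  (\<open>rotation_variation\<close>).

  The bound on the length follows from \<open>D = (L - 2 \<surd>(\<pi> A)) (L + 2 \<surd>(\<pi> A))\<close> once \<open>A\<close> is known to be
  positive. That is a consequence of the global existence of the flow: if \<open>A \<le> 0\<close>, then
  \<open>D \<ge> L\<^sup>2\<close>, so \<open>D' \<le> - 16 \<pi>\<^sup>2\<close>, and \<open>D\<close> would become negative in finite time.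

  The inequality between \<open>D\<close> and the curvature deviation is quadratic in an arc-length
  parametrization \<open>f\<close>: with \<open>w = 2 \<pi> / L\<close>, \<open>J\<close> the rotation by a right angle and
  \<open>T f = - f'' + w J f'\<close>, it states \<open>2 w\<^sup>2 \<langle>T f, f\<rangle> \<le> \<parallel>T f\<parallel>\<^sup>2\<close>. The kernel of \<open>T\<close>
  consists of circles, so \<open>f\<close> may be replaced by its difference from the circle of length \<open>L\<close> that is
  tangent to it at the base point (\<open>deficit_le\<close>). In a frame rotating with angular velocity
  \<open>w / 2\<close> the components of the difference are scalar functions with double zeros at both ends of the
  period, and for these the inequality follows by completing a square
  (\<open>wirtinger_doubly_vanishing_ends\<close>). The isoperimetric inequality \<open>0 \<le> \<langle>T f, f\<rangle>\<close> is treated in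
  the same way, with simple zeros and the classical square behind Wirtinger's inequality.
\<close>

section \<open>Wirtinger inequalities on an interval\<close>

lemma has_real_derivative_cot_mult:
  fixes k s :: real
  assumes "sin (k * s) \<noteq> 0"
  shows "((\<lambda>s. cot (k * s)) has_real_derivative - k * (1 + (cot (k * s))\<^sup>2)) (at s)"
proof -
  have "- k * (1 + (cot (k * s))\<^sup>2) = - inverse ((sin (k * s))\<^sup>2) * k"
    using assms sin_cos_squared_add[of "k * s"]
    by (simp add: cot_def field_simps flip: distrib_left)
  moreover have "((\<lambda>s. cot (k * s)) has_real_derivative - inverse ((sin (k * s))\<^sup>2) * k) (at s)"
    by (rule DERIV_chain2[OF DERIV_cot]) (use assms in \<open>auto intro!: derivative_eq_intros\<close>)
  ultimately show ?thesis by (simp only:)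
qed

lemma sin_pi_frac_pos:
  fixes L s :: real
  assumes "0 < s" "s < L"
  shows "0 < sin (pi / L * s)"
  using assms by (intro sin_gt_zero) (auto simp: field_simps)

text \<open>
  The two limits below control the singular coefficients in the completions of squares: a zero of
  \<open>h\<close> cancels the simple pole of the cotangent, a double zero cancels the pole of its square.
\<close>

lemma tendsto_cot_mult_at_right_0:
  fixes k :: real and h :: "real \<Rightarrow> real"
  assumes k: "k > 0" and h: "(h has_real_derivative h0) (at_right 0)" and h0: "h 0 = 0"
  shows "((\<lambda>s. cot (k * s) * h s) \<longlongrightarrow> h0 / k) (at_right 0)"
proof -
  have 1: "((\<lambda>s. h s / s) \<longlongrightarrow> h0) (at_right 0)"
    using h h0 by (simp add: has_field_derivative_iff)
  have "((\<lambda>s. sin (k * s)) has_real_derivative k) (at 0 within {0<..})"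
    by (auto intro!: derivative_eq_intros)
  then have 2: "((\<lambda>s. sin (k * s) / s) \<longlongrightarrow> k) (at_right 0)"
    by (simp add: has_field_derivative_iff)
  have 3: "((\<lambda>s. cos (k * s)) \<longlongrightarrow> cos (k * 0)) (at_right 0)"
    by (intro tendsto_intros)
  have "((\<lambda>s. cos (k * s) * ((h s / s) / (sin (k * s) / s))) \<longlongrightarrow> cos (k * 0) * (h0 / k)) (at_right 0)"
    using k by (intro tendsto_intros 1 2 3) auto
  moreover have "\<forall>\<^sub>F s in at_right 0. cos (k * s) * ((h s / s) / (sin (k * s) / s)) = cot (k * s) * h s"
    by (auto simp: eventually_at_right_less cot_def intro!: eventually_mono[OF eventually_at_right_less])
  ultimately show ?thesis
    by (simp add: tendsto_cong)
qed

lemma tendsto_cot_squared_mult_at_right_0: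
  fixes k L :: real and h h1 h2 :: "real \<Rightarrow> real"
  assumes k: "k = pi / L" and L: "L > 0"
    and h: "\<And>s. (h has_real_derivative h1 s) (at s)"
    and h1: "\<And>s. (h1 has_real_derivative h2 s) (at s)"
    and 0: "h 0 = 0" "h1 0 = 0"
  shows "((\<lambda>s. (cot (k * s))\<^sup>2 * h s) \<longlongrightarrow> h2 0 / (2 * k\<^sup>2)) (at_right 0)"
proof -
  have kpos: "k > 0" using k L by simp
  have ev: "\<forall>\<^sub>F s in at_right 0. 0 < s \<and> s < L / 2"
    using L by (intro eventually_at_rightI[of 0 "L/2"]) auto
  have sin: "sin (k * s) > 0" "cos (k * s) > 0" if "0 < s \<and> s < L / 2" for s
    unfolding k using that sin_pi_frac_pos[of s L] cos_gt_zero[of "pi / L * s"] L by (auto simp: field_simps)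
  have cont: "isCont h s" "isCont h1 s" for s
    using h h1 DERIV_isCont by blast+
  have "((\<lambda>s. h s / (sin (k * s))\<^sup>2) \<longlongrightarrow> h2 0 / (2 * k\<^sup>2)) (at_right 0)"
  proof (rule lhopital_right_0)
    show "(h \<longlongrightarrow> 0) (at_right 0)"
      using cont(1)[of 0] 0 by (auto simp: isCont_def intro: tendsto_within_subset)
    have "((\<lambda>s. (sin (k * s))\<^sup>2) \<longlongrightarrow> (sin (k * 0))\<^sup>2) (at_right 0)" by (intro tendsto_intros)
    then show "((\<lambda>s. (sin (k * s))\<^sup>2) \<longlongrightarrow> 0) (at_right 0)" by simp
    show "\<forall>\<^sub>F s in at_right 0. (sin (k * s))\<^sup>2 \<noteq> 0"
      by (rule eventually_mono[OF ev]) (use sin in force)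
    show "\<forall>\<^sub>F s in at_right 0. 2 * k * sin (k * s) * cos (k * s) \<noteq> 0"
      by (rule eventually_mono[OF ev]) (use sin kpos in force)
    show "\<forall>\<^sub>F s in at_right 0. (h has_real_derivative h1 s) (at s)" using h by simp
    show "\<forall>\<^sub>F s in at_right 0. ((\<lambda>s. (sin (k * s))\<^sup>2) has_real_derivative 2 * k * sin (k * s) * cos (k * s)) (at s)"
      by (intro always_eventually allI) (auto intro!: derivative_eq_intros)
    have "((\<lambda>s. cot (k * s) * h1 s) \<longlongrightarrow> h2 0 / k) (at_right 0)"
      by (rule tendsto_cot_mult_at_right_0[where h = h1 and ?h0.0 = "h2 0", OF kpos has_field_derivative_at_within[OF h1] 0(2)])
    then have "((\<lambda>s. cot (k * s) * h1 s / (2 * k * (cos (k * s))\<^sup>2)) \<longlongrightarrow> (h2 0 / k) / (2 * k * (cos (k * 0))\<^sup>2)) (at_right 0)"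
      using kpos by (intro tendsto_intros) auto
    then have *: "((\<lambda>s. cot (k * s) * h1 s / (2 * k * (cos (k * s))\<^sup>2)) \<longlongrightarrow> h2 0 / (2 * k\<^sup>2)) (at_right 0)"
      by (simp add: power2_eq_square mult_ac)
    have "\<forall>\<^sub>F s in at_right 0. cot (k * s) * h1 s / (2 * k * (cos (k * s))\<^sup>2) = h1 s / (2 * k * sin (k * s) * cos (k * s))"
      by (rule eventually_mono[OF ev]) (use sin in \<open>force simp: cot_def field_simps power2_eq_square\<close>)
    then show "((\<lambda>s. h1 s / (2 * k * sin (k * s) * cos (k * s))) \<longlongrightarrow> h2 0 / (2 * k\<^sup>2)) (at_right 0)"
      by (rule Lim_transform_eventually[OF *])
  qed
  moreover have "((\<lambda>s. (cos (k * s))\<^sup>2) \<longlongrightarrow> (cos (k * 0))\<^sup>2) (at_right 0)"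
    by (intro tendsto_intros)
  ultimately have "((\<lambda>s. (cos (k * s))\<^sup>2 * (h s / (sin (k * s))\<^sup>2)) \<longlongrightarrow> (cos (k * 0))\<^sup>2 * (h2 0 / (2 * k\<^sup>2))) (at_right 0)"
    by (rule tendsto_mult[rotated])
  then show ?thesis by (simp add: cot_def power_divide)
qed

lemma cot_pi_frac_reflect:
  fixes L s :: real
  assumes "L > 0"
  shows "cot (pi / L * (L - s)) = - cot (pi / L * s)"
proof -
  have "pi / L * (L - s) = pi - pi / L * s" using assms by (simp add: field_simps)
  then show ?thesis by (simp add: cot_def sin_diff cos_diff)
qed

lemma tendsto_at_left_reflect:
  fixes f :: "real \<Rightarrow> 'a::topological_space" and a :: real
  assumes "((\<lambda>s. f (a - s)) \<longlongrightarrow> l) (at_right 0)"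
  shows "(f \<longlongrightarrow> l) (at_left a)"
  using assms
  by (subst filterlim_at_left_to_right, subst filterlim_at_right_to_0) simp

lemma has_real_derivative_reflect:
  assumes "\<And>s::real. (h has_real_derivative h1 s) (at s)"
  shows "((\<lambda>s. h (a - s)) has_real_derivative - h1 (a - s)) (at s)"
proof -
  have "((\<lambda>s. a - s) has_real_derivative - 1) (at s)" by (auto intro!: derivative_eq_intros)
  from DERIV_chain2[OF assms this] show ?thesis by simp
qed

text \<open>
  Wirtinger's inequality by completing the square. The first eigenfunction \<open>sin (k s)\<close> has
  logarithmic derivative \<open>k cot (k s)\<close>, and \<open>h'\<^sup>2 - k\<^sup>2 h\<^sup>2\<close> differs from
  \<open>(h' - k cot (k s) h)\<^sup>2\<close> by the derivative of \<open>k cot (k s) h\<^sup>2\<close>, which vanishes at both ends.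
\<close>

lemma wirtinger_vanishing_ends:
  fixes L k :: real and h h1 :: "real \<Rightarrow> real"
  assumes L: "L > 0" and k: "k = pi / L"
    and h: "\<And>s. (h has_real_derivative h1 s) (at s)"
    and h1: "continuous_on {0..L} h1"
    and 0: "h 0 = 0" "h L = 0"
  shows "0 \<le> integral {0..L} (\<lambda>s. (h1 s)\<^sup>2 - k\<^sup>2 * (h s)\<^sup>2)"
proof -
  define B where "B s = k * cot (k * s) * (h s)\<^sup>2" for s
  have kpos: "k > 0" using k L by simp
  have cont: "isCont h s" for s using h DERIV_isCont by blast
  have lim: "((\<lambda>s. k * (cot (k * s) * g s) * g s) \<longlongrightarrow> 0) (at_right 0)"
    if g: "(g has_real_derivative g0) (at 0)" and g0: "g 0 = 0" for g g0
  proof -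
    have "(g \<longlongrightarrow> g 0) (at_right 0)"
      using DERIV_isCont[OF g] by (auto simp: isCont_def intro: tendsto_within_subset)
    with tendsto_cot_mult_at_right_0[OF kpos has_field_derivative_at_within[OF g] g0]
    have "((\<lambda>s. k * (cot (k * s) * g s) * g s) \<longlongrightarrow> k * (g0 / k) * g 0) (at_right 0)"
      by (intro tendsto_intros)
    then show ?thesis using g0 by simp
  qed
  have "continuous_on {0..L} B"
  proof (rule continuous_on_IccI)
    \<comment> \<open>The cotangent has poles at the ends, but as \<open>h\<close> is zero there the formula takes the value \<open>0\<close>,
      which is the limit.\<close>
    have "B 0 = 0" "B L = 0" using 0 by (auto simp: B_def)
    show "(B \<longlongrightarrow> B 0) (at_right 0)"
      using lim[OF h 0(1)] \<open>B 0 = 0\<close> by (simp add: B_def[abs_def] power2_eq_square mult.assoc)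
    have "((\<lambda>s. h (L - s)) has_real_derivative - h1 L) (at 0)"
      using has_real_derivative_reflect[of h h1 L 0, OF h] by simp
    from tendsto_minus[OF lim[OF this]] 0
    show "(B \<longlongrightarrow> B L) (at_left L)"
      using cot_pi_frac_reflect[OF L] k \<open>B L = 0\<close>
      by (intro tendsto_at_left_reflect) (simp add: B_def[abs_def] power2_eq_square mult.assoc)
    show "B \<midarrow>s\<rightarrow> B s" if "0 < s" "s < L" for s
    proof -
      have "sin (k * s) \<noteq> 0" using sin_pi_frac_pos[of s L] that k by simp
      then have "isCont B s" unfolding B_def[abs_def] by (intro continuous_intros cont) auto
      then show ?thesis by (simp add: isCont_def)
    qed
  qed (use L in auto)
  moreover have "(B has_vector_derivative (h1 s)\<^sup>2 - k\<^sup>2 * (h s)\<^sup>2 - (h1 s - k * cot (k * s) * h s)\<^sup>2) (at s)"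
    if "s \<in> {0<..<L}" for s
  proof -
    have "sin (k * s) \<noteq> 0" using sin_pi_frac_pos[of s L] that k by simp
    note has_real_derivative_cot_mult[OF this, derivative_intros]
    show ?thesis
      unfolding B_def[abs_def] has_real_derivative_iff_has_vector_derivative[symmetric]
      by (rule derivative_eq_intros h refl | simp)+ (simp add: algebra_simps power2_eq_square)
  qed
  ultimately have B: "((\<lambda>s. (h1 s)\<^sup>2 - k\<^sup>2 * (h s)\<^sup>2 - (h1 s - k * cot (k * s) * h s)\<^sup>2) has_integral (B L - B 0)) {0..L}"
    using L by (intro fundamental_theorem_of_calculus_interior) auto
  have "continuous_on {0..L} h" using cont by (simp add: continuous_at_imp_continuous_on)
  then have "(\<lambda>s. (h1 s)\<^sup>2 - k\<^sup>2 * (h s)\<^sup>2) integrable_on {0..L}"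
    by (intro integrable_continuous_real continuous_intros h1)
  from has_integral_diff[OF integrable_integral[OF this] B]
  have "((\<lambda>s. (h1 s - k * cot (k * s) * h s)\<^sup>2) has_integral
      integral {0..L} (\<lambda>s. (h1 s)\<^sup>2 - k\<^sup>2 * (h s)\<^sup>2)) {0..L}"
    using 0 by (simp add: B_def)
  then show ?thesis by (rule has_integral_nonneg) simp
qed

text \<open>
  The difference of the two integrands has Euler operator \<open>(\<partial>\<^sup>2 + k\<^sup>2) (\<partial>\<^sup>2 + 9 k\<^sup>2)\<close>, whose
  solutions with double zeros at both ends are spanned by \<open>sin\<^sup>3 (k s)\<close> and \<open>sin\<^sup>2 (k s) cos (k s)\<close>. It
  factors as \<open>N* N\<close>, where \<open>N h = h'' - 4 k cot (k s) h' + k\<^sup>2 (6 cot\<^sup>2 (k s) + 3) h\<close> is the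
  second-order operator with exactly these solutions: for \<open>h = sin\<^sup>2 (k s) v\<close> it equals
  \<open>sin\<^sup>2 (k s) (v'' + k\<^sup>2 v)\<close>. So the difference of the integrands is \<open>(N h)\<^sup>2\<close> plus the
  derivative of a boundary term, which the double zeros make vanish at both ends.
\<close>

lemma wirtinger_doubly_vanishing_ends:
  fixes L k :: real and h h1 h2 :: "real \<Rightarrow> real"
  assumes L: "L > 0" and k: "k = pi / L"
    and h: "\<And>s. (h has_real_derivative h1 s) (at s)"
    and h1: "\<And>s. (h1 has_real_derivative h2 s) (at s)"
    and h2: "continuous_on {0..L} h2"
    and 0: "h 0 = 0" "h L = 0" "h1 0 = 0" "h1 L = 0"
  shows "8 * k\<^sup>2 * integral {0..L} (\<lambda>s. (h1 s)\<^sup>2 - k\<^sup>2 * (h s)\<^sup>2)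
    \<le> integral {0..L} (\<lambda>s. (h2 s + k\<^sup>2 * h s)\<^sup>2)"
proof -
  define B where "B h h1 s = 4 * k * cot (k * s) * (h1 s)\<^sup>2
    - k\<^sup>2 * (12 * (cot (k * s))\<^sup>2 + 4) * h s * h1 s
    + 12 * k ^ 3 * (cot (k * s)) ^ 3 * (h s)\<^sup>2" for h h1 :: "real \<Rightarrow> real" and s
  have kpos: "k > 0" using k L by simp
  have cont: "isCont h s" "isCont h1 s" for s using h h1 DERIV_isCont by blast+
  have lim: "(B g g1 \<longlongrightarrow> 0) (at_right 0)"
    if g: "\<And>s. (g has_real_derivative g1 s) (at s)" and g1: "\<And>s. (g1 has_real_derivative g2 s) (at s)"
      and g0: "g 0 = 0" "g1 0 = 0" for g g1 g2
  proof -
    have l: "(g \<longlongrightarrow> 0) (at_right 0)" "(g1 \<longlongrightarrow> 0) (at_right 0)"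
      using DERIV_isCont[OF g, of 0] DERIV_isCont[OF g1, of 0] g0
      by (auto simp: isCont_def intro: tendsto_within_subset)
    have c: "((\<lambda>s. cot (k * s) * g s) \<longlongrightarrow> 0) (at_right 0)"
      using tendsto_cot_mult_at_right_0[OF kpos has_field_derivative_at_within[OF g] g0(1)] g0 by simp
    have c1: "((\<lambda>s. cot (k * s) * g1 s) \<longlongrightarrow> g2 0 / k) (at_right 0)"
      by (rule tendsto_cot_mult_at_right_0[OF kpos has_field_derivative_at_within[OF g1] g0(2)])
    have c2: "((\<lambda>s. (cot (k * s))\<^sup>2 * g s) \<longlongrightarrow> g2 0 / (2 * k\<^sup>2)) (at_right 0)"
      by (rule tendsto_cot_squared_mult_at_right_0[OF k L g g1 g0])
    have "((\<lambda>s. 4 * k * (cot (k * s) * g1 s) * g1 s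
        - k\<^sup>2 * (12 * ((cot (k * s))\<^sup>2 * g s) * g1 s + 4 * g s * g1 s)
        + 12 * k ^ 3 * ((cot (k * s))\<^sup>2 * g s) * (cot (k * s) * g s)) \<longlongrightarrow>
       4 * k * (g2 0 / k) * 0 - k\<^sup>2 * (12 * (g2 0 / (2 * k\<^sup>2)) * 0 + 4 * 0 * 0)
        + 12 * k ^ 3 * (g2 0 / (2 * k\<^sup>2)) * 0) (at_right 0)"
      by (intro tendsto_intros l c c1 c2)
    then show ?thesis
      by (simp add: B_def[abs_def] power2_eq_square power3_eq_cube algebra_simps)
  qed
  have "continuous_on {0..L} (B h h1)"
  proof (rule continuous_on_IccI)
    have B0: "B h h1 0 = 0" "B h h1 L = 0" using 0 by (auto simp: B_def)
    show "(B h h1 \<longlongrightarrow> B h h1 0) (at_right 0)"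
      using lim[OF h h1 0(1,3)] B0 by simp
    have "((\<lambda>s. h (L - s)) has_real_derivative - h1 (L - s)) (at s)"
      "((\<lambda>s. - h1 (L - s)) has_real_derivative h2 (L - s)) (at s)" for s
      using has_real_derivative_reflect[of h h1, OF h] DERIV_minus[OF has_real_derivative_reflect[of h1 h2, OF h1]]
      by simp_all
    from tendsto_minus[OF lim[OF this]] 0
    show "(B h h1 \<longlongrightarrow> B h h1 L) (at_left L)"
      using cot_pi_frac_reflect[OF L] k B0
      by (intro tendsto_at_left_reflect) (simp add: B_def[abs_def])
    show "B h h1 \<midarrow>s\<rightarrow> B h h1 s" if "0 < s" "s < L" for s
    proof -
      have "sin (k * s) \<noteq> 0" using sin_pi_frac_pos[of s L] that k by simp
      then have "isCont (B h h1) s" unfolding B_def[abs_def] by (intro continuous_intros cont) auto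
      then show ?thesis by (simp add: isCont_def)
    qed
  qed (use L in auto)
  moreover have "(B h h1 has_vector_derivative
      ((h2 s + k\<^sup>2 * h s)\<^sup>2 - 8 * k\<^sup>2 * ((h1 s)\<^sup>2 - k\<^sup>2 * (h s)\<^sup>2))
      - (h2 s - 4 * k * cot (k * s) * h1 s + k\<^sup>2 * (6 * (cot (k * s))\<^sup>2 + 3) * h s)\<^sup>2) (at s)"
    if "s \<in> {0<..<L}" for s
  proof -
    have "sin (k * s) \<noteq> 0" using sin_pi_frac_pos[of s L] that k by simp
    note has_real_derivative_cot_mult[OF this, derivative_intros]
    show ?thesis
      unfolding B_def[abs_def] has_real_derivative_iff_has_vector_derivative[symmetric]
      by (rule derivative_eq_intros h h1 refl | simp)+ (simp add: field_simps power2_eq_square power3_eq_cube)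
  qed
  ultimately have B: "((\<lambda>s. ((h2 s + k\<^sup>2 * h s)\<^sup>2 - 8 * k\<^sup>2 * ((h1 s)\<^sup>2 - k\<^sup>2 * (h s)\<^sup>2))
      - (h2 s - 4 * k * cot (k * s) * h1 s + k\<^sup>2 * (6 * (cot (k * s))\<^sup>2 + 3) * h s)\<^sup>2)
      has_integral (B h h1 L - B h h1 0)) {0..L}"
    using L by (intro fundamental_theorem_of_calculus_interior) auto
  have c: "continuous_on {0..L} h" "continuous_on {0..L} h1"
    using cont by (simp_all add: continuous_at_imp_continuous_on)
  have i: "(\<lambda>s. (h2 s + k\<^sup>2 * h s)\<^sup>2) integrable_on {0..L}"
     "(\<lambda>s. (h1 s)\<^sup>2 - k\<^sup>2 * (h s)\<^sup>2) integrable_on {0..L}"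
    by (intro integrable_continuous_real continuous_intros h2 c)+
  have "((\<lambda>s. (h2 s + k\<^sup>2 * h s)\<^sup>2 - 8 * k\<^sup>2 * ((h1 s)\<^sup>2 - k\<^sup>2 * (h s)\<^sup>2)) has_integral
      integral {0..L} (\<lambda>s. (h2 s + k\<^sup>2 * h s)\<^sup>2)
      - 8 * k\<^sup>2 * integral {0..L} (\<lambda>s. (h1 s)\<^sup>2 - k\<^sup>2 * (h s)\<^sup>2)) {0..L}"
    by (intro has_integral_diff has_integral_mult_right integrable_integral i)
  from has_integral_diff[OF this B]
  have "((\<lambda>s. (h2 s - 4 * k * cot (k * s) * h1 s + k\<^sup>2 * (6 * (cot (k * s))\<^sup>2 + 3) * h s)\<^sup>2) has_integral
      integral {0..L} (\<lambda>s. (h2 s + k\<^sup>2 * h s)\<^sup>2)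
      - 8 * k\<^sup>2 * integral {0..L} (\<lambda>s. (h1 s)\<^sup>2 - k\<^sup>2 * (h s)\<^sup>2)) {0..L}"
    using 0 by (simp add: B_def)
  then have "0 \<le> integral {0..L} (\<lambda>s. (h2 s + k\<^sup>2 * h s)\<^sup>2)
      - 8 * k\<^sup>2 * integral {0..L} (\<lambda>s. (h1 s)\<^sup>2 - k\<^sup>2 * (h s)\<^sup>2)"
    by (rule has_integral_nonneg) simp
  then show ?thesis by simp
qed

section \<open>Quadratic inequalities for closed curves in components\<close>

lemma has_integral_of_DERIV:
  fixes E D :: "real \<Rightarrow> real"
  assumes "a \<le> b" "\<And>s. (E has_real_derivative D s) (at s)"
  shows "(D has_integral (E b - E a)) {a..b}"
  using assms by (intro fundamental_theorem_of_calculus)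
    (simp_all add: has_field_derivative_at_within flip: has_real_derivative_iff_has_vector_derivative)

lemma rotated_sum_squares:
  fixes \<theta> u v :: real
  shows "(cos \<theta> * u + sin \<theta> * v)\<^sup>2 + (cos \<theta> * v - sin \<theta> * u)\<^sup>2 = u\<^sup>2 + v\<^sup>2"
proof -
  have "(cos \<theta> * u + sin \<theta> * v)\<^sup>2 + (cos \<theta> * v - sin \<theta> * u)\<^sup>2 =
    ((sin \<theta>)\<^sup>2 + (cos \<theta>)\<^sup>2) * (u\<^sup>2 + v\<^sup>2)"
    by algebra
  then show ?thesis by simp
qed

text \<open>
  For a closed curve \<open>(x, y)\<close> of length \<open>L\<close> parametrized by arc length and \<open>w = 2 \<pi> / L\<close>, the
  integral over a period is \<open>L - 4 \<pi> A / L\<close>, the isoperimetric deficit divided by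
  \<open>L\<close>. For an arbitrary periodic \<open>f = (x, y)\<close> it is the quadratic form of the operator \<open>T f = - f'' + w J f'\<close>, with \<open>J\<close> the rotation by a
  right angle, whose kernel consists of the points and the circles traversed with angular velocity \<open>w\<close>.
\<close>

definition deficit_density :: "real \<Rightarrow> real \<Rightarrow> real \<Rightarrow> real \<Rightarrow> real \<Rightarrow> real" where
  "deficit_density w x y x1 y1 = x1\<^sup>2 + y1\<^sup>2 - w * (x * y1 - y * x1)"

text \<open>
  Passing to a frame that rotates with half the angular velocity decouples the components: the
  form becomes a sum of two scalar Wirtinger forms.
\<close>

lemma rotated_deficit_density:
  fixes k \<theta> x y x1 y1 :: real
  shows "((cos \<theta> * (x1 + k * y) + sin \<theta> * (y1 - k * x))\<^sup>2 - k\<^sup>2 * (cos \<theta> * x + sin \<theta> * y)\<^sup>2)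
    + ((cos \<theta> * (y1 - k * x) - sin \<theta> * (x1 + k * y))\<^sup>2 - k\<^sup>2 * (cos \<theta> * y - sin \<theta> * x)\<^sup>2)
    = deficit_density (2 * k) x y x1 y1" (is "?a - k\<^sup>2 * ?b + (?c - k\<^sup>2 * ?d) = _")
proof -
  have "?a - k\<^sup>2 * ?b + (?c - k\<^sup>2 * ?d) = (?a + ?c) - k\<^sup>2 * (?b + ?d)"
    by (simp add: algebra_simps)
  also have "\<dots> = (x1 + k * y)\<^sup>2 + (y1 - k * x)\<^sup>2 - k\<^sup>2 * (x\<^sup>2 + y\<^sup>2)"
    by (simp only: rotated_sum_squares)
  also have "\<dots> = deficit_density (2 * k) x y x1 y1"
    by (simp add: deficit_density_def power2_eq_square algebra_simps)
  finally show ?thesis .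
qed

lemma deficit_nonneg_of_vanishing_ends:
  fixes L w :: real and x y x1 y1 :: "real \<Rightarrow> real"
  assumes L: "L > 0" and w: "w = 2 * pi / L"
    and x: "\<And>s. (x has_real_derivative x1 s) (at s)" and y: "\<And>s. (y has_real_derivative y1 s) (at s)"
    and x1: "continuous_on {0..L} x1" and y1: "continuous_on {0..L} y1"
    and 0: "x 0 = 0" "y 0 = 0" "x L = 0" "y L = 0"
  shows "0 \<le> integral {0..L} (\<lambda>s. deficit_density w (x s) (y s) (x1 s) (y1 s))"
proof -
  define k where "k = w / 2"
  have k: "k = pi / L" and w: "w = 2 * k" using w by (auto simp: k_def)
  define u v u1 v1 where "u s = cos (k * s) * x s + sin (k * s) * y s"
    and "v s = cos (k * s) * y s - sin (k * s) * x s"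
    and "u1 s = cos (k * s) * (x1 s + k * y s) + sin (k * s) * (y1 s - k * x s)"
    and "v1 s = cos (k * s) * (y1 s - k * x s) - sin (k * s) * (x1 s + k * y s)" for s
  have d: "(u has_real_derivative u1 s) (at s)" "(v has_real_derivative v1 s) (at s)" for s
    unfolding u_def[abs_def] v_def[abs_def] u1_def v1_def
    by (auto intro!: derivative_eq_intros x y simp: algebra_simps)
  have c: "continuous_on {0..L} x" "continuous_on {0..L} y"
    using x y DERIV_isCont by (blast intro: continuous_at_imp_continuous_on)+
  have c1: "continuous_on {0..L} u" "continuous_on {0..L} v" "continuous_on {0..L} u1" "continuous_on {0..L} v1"
    unfolding u_def[abs_def] v_def[abs_def] u1_def[abs_def] v1_def[abs_def]
    by (intro continuous_intros c x1 y1)+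
  have "0 \<le> integral {0..L} (\<lambda>s. (u1 s)\<^sup>2 - k\<^sup>2 * (u s)\<^sup>2) + integral {0..L} (\<lambda>s. (v1 s)\<^sup>2 - k\<^sup>2 * (v s)\<^sup>2)"
    by (intro add_nonneg_nonneg wirtinger_vanishing_ends[OF L k] d c1) (auto simp: u_def v_def 0)
  also have "\<dots> = integral {0..L} (\<lambda>s. ((u1 s)\<^sup>2 - k\<^sup>2 * (u s)\<^sup>2) + ((v1 s)\<^sup>2 - k\<^sup>2 * (v s)\<^sup>2))"
    by (intro integral_add[symmetric] integrable_continuous_real continuous_intros c1)
  finally show ?thesis
    by (simp only: u_def v_def u1_def v1_def rotated_deficit_density w)
qed

lemma deficit_le_of_doubly_vanishing_ends:
  fixes L w :: real and x y x1 y1 x2 y2 :: "real \<Rightarrow> real"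
  assumes L: "L > 0" and w: "w = 2 * pi / L"
    and x: "\<And>s. (x has_real_derivative x1 s) (at s)" and y: "\<And>s. (y has_real_derivative y1 s) (at s)"
    and x1: "\<And>s. (x1 has_real_derivative x2 s) (at s)" and y1: "\<And>s. (y1 has_real_derivative y2 s) (at s)"
    and x2: "continuous_on {0..L} x2" and y2: "continuous_on {0..L} y2"
    and 0: "x 0 = 0" "y 0 = 0" "x L = 0" "y L = 0" "x1 0 = 0" "y1 0 = 0" "x1 L = 0" "y1 L = 0"
  shows "2 * w\<^sup>2 * integral {0..L} (\<lambda>s. deficit_density w (x s) (y s) (x1 s) (y1 s))
    \<le> integral {0..L} (\<lambda>s. (x2 s + w * y1 s)\<^sup>2 + (y2 s - w * x1 s)\<^sup>2)"
proof -
  define k where "k = w / 2"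
  have k: "k = pi / L" and w: "w = 2 * k" using w by (auto simp: k_def)
  define u v u1 v1 u2 v2 where "u s = cos (k * s) * x s + sin (k * s) * y s"
    and "v s = cos (k * s) * y s - sin (k * s) * x s"
    and "u1 s = cos (k * s) * (x1 s + k * y s) + sin (k * s) * (y1 s - k * x s)"
    and "v1 s = cos (k * s) * (y1 s - k * x s) - sin (k * s) * (x1 s + k * y s)"
    and "u2 s = cos (k * s) * (x2 s + 2 * k * y1 s - k\<^sup>2 * x s) + sin (k * s) * (y2 s - 2 * k * x1 s - k\<^sup>2 * y s)"
    and "v2 s = cos (k * s) * (y2 s - 2 * k * x1 s - k\<^sup>2 * y s) - sin (k * s) * (x2 s + 2 * k * y1 s - k\<^sup>2 * x s)" for s
  have d: "(u has_real_derivative u1 s) (at s)" "(v has_real_derivative v1 s) (at s)" 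
    "(u1 has_real_derivative u2 s) (at s)" "(v1 has_real_derivative v2 s) (at s)" for s
    unfolding u_def[abs_def] v_def[abs_def] u1_def[abs_def] v1_def[abs_def] u2_def v2_def
    by (auto intro!: derivative_eq_intros x y x1 y1 simp: algebra_simps power2_eq_square)
  have c: "continuous_on {0..L} x" "continuous_on {0..L} y" "continuous_on {0..L} x1" "continuous_on {0..L} y1"
    using x y x1 y1 DERIV_isCont by (blast intro: continuous_at_imp_continuous_on)+
  have c1: "continuous_on {0..L} u" "continuous_on {0..L} v" "continuous_on {0..L} u1" "continuous_on {0..L} v1"
     "continuous_on {0..L} u2" "continuous_on {0..L} v2"
    unfolding u_def[abs_def] v_def[abs_def] u1_def[abs_def] v1_def[abs_def] u2_def[abs_def] v2_def[abs_def]
    by (intro continuous_intros c x2 y2)+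
  have "integral {0..L} (\<lambda>s. deficit_density w (x s) (y s) (x1 s) (y1 s))
    = integral {0..L} (\<lambda>s. ((u1 s)\<^sup>2 - k\<^sup>2 * (u s)\<^sup>2) + ((v1 s)\<^sup>2 - k\<^sup>2 * (v s)\<^sup>2))"
    by (simp only: u_def v_def u1_def v1_def rotated_deficit_density w)
  also have "\<dots> = integral {0..L} (\<lambda>s. (u1 s)\<^sup>2 - k\<^sup>2 * (u s)\<^sup>2) + integral {0..L} (\<lambda>s. (v1 s)\<^sup>2 - k\<^sup>2 * (v s)\<^sup>2)"
    by (intro integral_add integrable_continuous_real continuous_intros c1)
  finally have "2 * w\<^sup>2 * integral {0..L} (\<lambda>s. deficit_density w (x s) (y s) (x1 s) (y1 s)) = 
     8 * k\<^sup>2 * integral {0..L} (\<lambda>s. (u1 s)\<^sup>2 - k\<^sup>2 * (u s)\<^sup>2)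
     + 8 * k\<^sup>2 * integral {0..L} (\<lambda>s. (v1 s)\<^sup>2 - k\<^sup>2 * (v s)\<^sup>2)"
    by (simp add: w power2_eq_square algebra_simps)
  also have "\<dots> \<le> integral {0..L} (\<lambda>s. (u2 s + k\<^sup>2 * u s)\<^sup>2) + integral {0..L} (\<lambda>s. (v2 s + k\<^sup>2 * v s)\<^sup>2)"
    by (intro add_mono wirtinger_doubly_vanishing_ends[OF L k] d c1) (auto simp: u_def v_def u1_def v1_def 0)
  also have "\<dots> = integral {0..L} (\<lambda>s. (u2 s + k\<^sup>2 * u s)\<^sup>2 + (v2 s + k\<^sup>2 * v s)\<^sup>2)"
    by (intro integral_add[symmetric] integrable_continuous_real continuous_intros c1)
  also have "(\<lambda>s. (u2 s + k\<^sup>2 * u s)\<^sup>2 + (v2 s + k\<^sup>2 * v s)\<^sup>2) = (\<lambda>s. (x2 s + w * y1 s)\<^sup>2 + (y2 s - w * x1 s)\<^sup>2)"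
  proof
    fix s
    have "u2 s + k\<^sup>2 * u s = cos (k * s) * (x2 s + w * y1 s) + sin (k * s) * (y2 s - w * x1 s)"
      "v2 s + k\<^sup>2 * v s = cos (k * s) * (y2 s - w * x1 s) - sin (k * s) * (x2 s + w * y1 s)"
      by (simp_all add: u_def v_def u2_def v2_def w algebra_simps)
    then show "(u2 s + k\<^sup>2 * u s)\<^sup>2 + (v2 s + k\<^sup>2 * v s)\<^sup>2 = (x2 s + w * y1 s)\<^sup>2 + (y2 s - w * x1 s)\<^sup>2"
      by (simp only: rotated_sum_squares)
  qed
  finally show ?thesis .
qed

text \<open>
  A translation makes the curve start and end at the origin; it changes the integrand by an exact
  derivative.
\<close>

lemma deficit_nonneg:
  fixes L w :: real and x y x1 y1 :: "real \<Rightarrow> real"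
  assumes L: "L > 0" and w: "w = 2 * pi / L"
    and x: "\<And>s. (x has_real_derivative x1 s) (at s)" and y: "\<And>s. (y has_real_derivative y1 s) (at s)"
    and x1: "continuous_on {0..L} x1" and y1: "continuous_on {0..L} y1"
    and per: "x L = x 0" "y L = y 0"
  shows "0 \<le> integral {0..L} (\<lambda>s. deficit_density w (x s) (y s) (x1 s) (y1 s))"
proof -
  let ?P = "\<lambda>s. deficit_density w (x s - x 0) (y s - y 0) (x1 s) (y1 s)"
  have c: "continuous_on {0..L} x" "continuous_on {0..L} y"
    using x y DERIV_isCont by (blast intro: continuous_at_imp_continuous_on)+
  have "((\<lambda>s. x s - x 0) has_real_derivative x1 s) (at s)" "((\<lambda>s. y s - y 0) has_real_derivative y1 s) (at s)" for s
    using DERIV_diff[OF x DERIV_const] DERIV_diff[OF y DERIV_const] by auto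
  from deficit_nonneg_of_vanishing_ends[OF L w this x1 y1]
  have "0 \<le> integral {0..L} ?P" by (simp add: per)
  also have "\<dots> = integral {0..L} (\<lambda>s. deficit_density w (x s) (y s) (x1 s) (y1 s))"
  proof -
    define a b where "a = x 0" and "b = y 0"
    have "((\<lambda>s. w * (a * y s - b * x s)) has_real_derivative w * (a * y1 s - b * x1 s)) (at s)" for s
      by (auto intro!: derivative_eq_intros x y)
    then have "((\<lambda>s. w * (a * y1 s - b * x1 s)) has_integral
       (w * (a * y L - b * x L) - w * (a * y 0 - b * x 0))) {0..L}"
      using L by (intro has_integral_of_DERIV) auto
    then have *: "((\<lambda>s. w * (x 0 * y1 s - y 0 * x1 s)) has_integral 0) {0..L}"
      by (simp add: per a_def b_def)
    have "(?P has_integral integral {0..L} ?P) {0..L}"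
      unfolding deficit_density_def
      by (intro integrable_integral integrable_continuous_real continuous_intros c x1 y1)
    from has_integral_diff[OF this *]
    have "((\<lambda>s. ?P s - w * (x 0 * y1 s - y 0 * x1 s)) has_integral integral {0..L} ?P) {0..L}"
      by simp
    moreover have "(\<lambda>s. ?P s - w * (x 0 * y1 s - y 0 * x1 s)) = (\<lambda>s. deficit_density w (x s) (y s) (x1 s) (y1 s))"
      by (auto simp: deficit_density_def algebra_simps)
    ultimately show ?thesis by (simp add: integral_unique)
  qed
  finally show ?thesis .
qed

text \<open>
  In terms of \<open>T f = - f'' + w J f'\<close> the claim is \<open>2 w\<^sup>2 \<langle>T f, f\<rangle> \<le> \<parallel>T f\<parallel>\<^sup>2\<close>; in Fourier modes
  with \<open>w = 1\<close> it reads \<open>2 n (n - 1) \<le> n\<^sup>2 (n - 1)\<^sup>2\<close>, so it holds because \<open>n (n - 1)\<close> never lies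
  strictly between \<open>0\<close> and \<open>2\<close>. Fourier series are avoided by subtracting an element of the
  kernel of \<open>T\<close>, which affects neither side: the circle with angular velocity \<open>w\<close> that passes
  through the curve's initial point with the same velocity. What remains vanishes to second order
  at both ends of the period.
\<close>

lemma deficit_le:
  fixes L w :: real and x y x1 y1 x2 y2 :: "real \<Rightarrow> real"
  assumes L: "L > 0" and w: "w = 2 * pi / L"
    and x: "\<And>s. (x has_real_derivative x1 s) (at s)" and y: "\<And>s. (y has_real_derivative y1 s) (at s)"
    and x1: "\<And>s. (x1 has_real_derivative x2 s) (at s)" and y1: "\<And>s. (y1 has_real_derivative y2 s) (at s)"
    and x2: "continuous_on {0..L} x2" and y2: "continuous_on {0..L} y2"
    and per: "x L = x 0" "y L = y 0" "x1 L = x1 0" "y1 L = y1 0"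
  shows "2 * w\<^sup>2 * integral {0..L} (\<lambda>s. deficit_density w (x s) (y s) (x1 s) (y1 s))
    \<le> integral {0..L} (\<lambda>s. (x2 s + w * y1 s)\<^sup>2 + (y2 s - w * x1 s)\<^sup>2)"
proof -
  have wL: "w * L = 2 * pi" "w \<noteq> 0" using L w by auto
  \<comment> \<open>The comparison circle will be \<open>(p, q)\<close>, with velocity \<open>(p1, q1)\<close>: rotate the initial velocity and integrate.\<close>
  define p1 q1 where "p1 s = x1 0 * cos (w * s) - y1 0 * sin (w * s)"
    and "q1 s = x1 0 * sin (w * s) + y1 0 * cos (w * s)" for s
  define p q where "p s = x 0 + (q1 s - y1 0) / w" and "q s = y 0 - (p1 s - x1 0) / w" for s
  have d1: "(p1 has_real_derivative - w * q1 s) (at s)" "(q1 has_real_derivative w * p1 s) (at s)" for s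
    unfolding p1_def[abs_def] q1_def[abs_def]
    by (auto intro!: derivative_eq_intros simp: algebra_simps)
  have d: "(p has_real_derivative p1 s) (at s)" "(q has_real_derivative q1 s) (at s)" for s
    unfolding p_def[abs_def] q_def[abs_def]
    using wL by (auto intro!: derivative_eq_intros d1)
  have e1: "p1 0 = x1 0" "q1 0 = y1 0" "p1 L = x1 0" "q1 L = y1 0"
    by (auto simp: p1_def q1_def wL)
  then have e: "p 0 = x 0" "q 0 = y 0" "p L = x 0" "q L = y 0"
    by (auto simp: p_def q_def)
  have c: "continuous_on {0..L} x" "continuous_on {0..L} y" "continuous_on {0..L} x1" "continuous_on {0..L} y1"
     "continuous_on {0..L} p" "continuous_on {0..L} q" "continuous_on {0..L} p1" "continuous_on {0..L} q1"
    using x y x1 y1 d d1 DERIV_isCont by (blast intro: continuous_at_imp_continuous_on)+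
  let ?P = "\<lambda>s. deficit_density w (x s - p s) (y s - q s) (x1 s - p1 s) (y1 s - q1 s)"
  let ?Q = "\<lambda>s. deficit_density w (x s) (y s) (x1 s) (y1 s)"
  have "2 * w\<^sup>2 * integral {0..L} ?P \<le> integral {0..L}
      (\<lambda>s. ((x2 s + w * q1 s) + w * (y1 s - q1 s))\<^sup>2 + ((y2 s - w * p1 s) - w * (x1 s - p1 s))\<^sup>2)"
  proof (rule deficit_le_of_doubly_vanishing_ends[OF L w])
    show "continuous_on {0..L} (\<lambda>s. x2 s + w * q1 s)" "continuous_on {0..L} (\<lambda>s. y2 s - w * p1 s)"
      by (intro continuous_intros c x2 y2)+
  qed (auto intro!: derivative_eq_intros x y x1 y1 d d1 simp: e e1 per)
  also have "\<dots> = integral {0..L} (\<lambda>s. (x2 s + w * y1 s)\<^sup>2 + (y2 s - w * x1 s)\<^sup>2)"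
    by (simp add: algebra_simps)
  also have "integral {0..L} ?P = integral {0..L} ?Q"
  proof -
    \<comment> \<open>As \<open>T d = 0\<close> for the circle \<open>d = (p, q)\<close>, the terms that involve \<open>d\<close> are exact, with primitive \<open>E\<close>.\<close>
    define E where "E s = 2 * ((x s - p s) * p1 s + (y s - q s) * q1 s)
      - w * (p s * (y s - q s) - q s * (x s - p s)) + p s * p1 s + q s * q1 s" for s
    have "(E has_real_derivative ?Q s - ?P s) (at s)" for s
      unfolding E_def[abs_def] deficit_density_def
      by (rule derivative_eq_intros x y d d1 refl)+ (simp add: algebra_simps power2_eq_square)
    then have "((\<lambda>s. ?Q s - ?P s) has_integral (E L - E 0)) {0..L}"
      using L by (intro has_integral_of_DERIV) auto
    moreover have "E L = E 0" by (simp add: E_def e e1 per)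
    ultimately have *: "((\<lambda>s. ?Q s - ?P s) has_integral 0) {0..L}" by simp
    have "?P integrable_on {0..L}"
      unfolding deficit_density_def
      by (intro integrable_continuous_real continuous_intros c)
    from has_integral_add[OF * integrable_integral[OF this]] show ?thesis
      by (simp add: integral_unique)
  qed
  finally show ?thesis .
qed

section \<open>Geometry of a regular closed curve in arc length\<close>

definition rot90 :: "real^2 \<Rightarrow> real^2" where
  "rot90 v = vector [- (v $ 2), v $ 1]"

lemma rot90_nth [simp]: "rot90 v $ 1 = - (v $ 2)" "rot90 v $ 2 = v $ 1"
  by (simp_all add: rot90_def)

lemma inner_real2: "(u :: real^2) \<bullet> v = u $ 1 * v $ 1 + u $ 2 * v $ 2"
  by (simp add: inner_vec_def sum_2)

lemma bounded_linear_rot90: "bounded_linear rot90"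
proof -
  have "linear rot90"
    by (rule linearI) (simp_all add: vec_eq_iff forall_2)
  then show ?thesis by (simp add: linear_conv_bounded_linear)
qed

lemmas has_vector_derivative_rot90 [derivative_intros] = bounded_linear.has_vector_derivative[OF bounded_linear_rot90]
lemmas continuous_on_rot90 [continuous_intros] = bounded_linear.continuous_on[OF bounded_linear_rot90]
lemmas rot90_scaleR = linear_cmul[OF bounded_linear.linear[OF bounded_linear_rot90]]

lemma has_real_derivative_inner:
  fixes f g :: "real \<Rightarrow> 'a::real_inner"
  assumes "(f has_vector_derivative f') (at t within S)" "(g has_vector_derivative g') (at t within S)"
  shows "((\<lambda>t. f t \<bullet> g t) has_real_derivative f t \<bullet> g' + f' \<bullet> g t) (at t within S)"
  using bounded_bilinear.has_vector_derivative[OF bounded_bilinear_inner assms]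
  by (simp add: has_real_derivative_iff_has_vector_derivative)

lemma has_real_derivative_norm:
  fixes f :: "real \<Rightarrow> 'a::real_inner"
  assumes "(f has_vector_derivative f') (at t within S)" "f t \<noteq> 0"
  shows "((\<lambda>t. norm (f t)) has_real_derivative (f t \<bullet> f') / norm (f t)) (at t within S)"
proof -
  have "f t \<bullet> f t > 0" using assms(2) by simp
  from DERIV_chain2[OF DERIV_real_sqrt[OF this] has_real_derivative_inner[OF assms(1) assms(1)]]
  show ?thesis
    unfolding norm_eq_sqrt_inner by (simp add: inner_commute field_simps)
qed

text \<open>
  A regular closed curve with its first two derivatives. Every arc-length quantity is pulled back to
  the given parameter, where it is an explicit expression in \<open>c\<close>, \<open>c1\<close> and \<open>c2\<close>: for a
  moving curve the arc-length parameter itself depends on time, so it is in this form that time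
  derivatives are taken.
\<close>

locale regular_closed_curve =
  fixes c c1 c2 :: "real \<Rightarrow> real^2"
  assumes deriv: "\<And>p. (c has_vector_derivative c1 p) (at p)"
    and deriv1: "\<And>p. (c1 has_vector_derivative c2 p) (at p)"
    and cont2: "continuous_on UNIV c2"
    and periodic: "\<And>p. c (p + 1) = c p"
    and regular: "\<And>p. c1 p \<noteq> 0"
begin

definition tangent :: "real \<Rightarrow> real^2" where
  "tangent p = c1 p /\<^sub>R norm (c1 p)"

definition tangent_deriv :: "real \<Rightarrow> real^2" where
  "tangent_deriv p = c2 p /\<^sub>R norm (c1 p) - ((c1 p \<bullet> c2 p) / norm (c1 p) ^ 3) *\<^sub>R c1 p"

abbreviation "len \<equiv> curve_length c"
abbreviation "\<sigma> \<equiv> arclength c"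
abbreviation "\<rho> \<equiv> inv (arclength c)"

lemma norm_c1_pos: "norm (c1 p) > 0"
  using regular by simp

lemma vector_derivative_c [simp]: "vector_derivative c (at p) = c1 p"
  using deriv by (rule vector_derivative_at)

lemma cont: "continuous_on S c" "continuous_on S c1" "continuous_on S c2"
  using deriv deriv1 cont2 has_vector_derivative_continuous continuous_on_subset
  by (blast intro: continuous_at_imp_continuous_on)+

lemma cont_speed: "continuous_on S (\<lambda>p. norm (c1 p))"
  by (intro continuous_intros cont)

lemma periodic1: "c1 (p + 1) = c1 p"
proof -
  have "((\<lambda>q. q + 1) has_vector_derivative 1) (at p)"
    by (auto intro!: derivative_eq_intros)
  from vector_diff_chain_at[OF this deriv]
  have "((\<lambda>q. c (q + 1)) has_vector_derivative c1 (p + 1)) (at p)"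
    by (simp add: o_def)
  then show ?thesis using deriv[of p] by (simp add: periodic vector_derivative_unique_at)
qed

lemma tangent_has_vector_derivative: "(tangent has_vector_derivative tangent_deriv p) (at p)"
  unfolding tangent_def[abs_def] tangent_deriv_def
  using regular[of p]
  by (auto intro!: derivative_eq_intros deriv1 has_real_derivative_norm
     simp: power3_eq_cube power2_eq_square divide_simps)

lemma cont_tangent: "continuous_on S tangent" "continuous_on S tangent_deriv"
  unfolding tangent_def[abs_def] tangent_deriv_def[abs_def]
  by (intro continuous_intros cont; simp add: regular)+

lemma tangent_inner: "tangent p \<bullet> tangent p = 1"
  using regular[of p] by (simp add: tangent_def power2_norm_eq_inner[symmetric] power2_eq_square)

lemma speed_times_tangent: "norm (c1 p) *\<^sub>R tangent p = c1 p"
  using regular by (simp add: tangent_def)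

text \<open>
  The signed definition of the arc length is, near any given parameter, an ordinary integral from a
  fixed left end point, up to a constant.
\<close>

lemma arclength_has_derivative: "(\<sigma> has_real_derivative norm (c1 p)) (at p)"
proof -
  let ?v = "\<lambda>p. norm (c1 p)"
  define M where "M = \<bar>p\<bar> + 1"
  have i: "?v integrable_on {a..b}" for a b
    by (intro integrable_continuous_real cont_speed)
  have eq: "\<sigma> q = integral {-M..q} ?v - integral {-M..0} ?v" if "q \<in> {-M<..<M}" for q
    using that Henstock_Kurzweil_Integration.integral_combine[where a = "-M" and c = 0 and b = q and f = ?v]
      Henstock_Kurzweil_Integration.integral_combine[where a = "-M" and c = q and b = 0 and f = ?v] i
    by (auto simp: arclength_def M_def)
  have "((\<lambda>q. integral {-M..q} ?v) has_real_derivative ?v p) (at p within {-M..M})"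
    by (rule integral_has_real_derivative[OF cont_speed]) (auto simp: M_def)
  then have "((\<lambda>q. integral {-M..q} ?v) has_real_derivative ?v p) (at p)"
    by (subst (asm) at_within_interior) (auto simp: M_def)
  then have "((\<lambda>q. integral {-M..q} ?v - integral {-M..0} ?v) has_real_derivative ?v p) (at p)"
    by (auto intro!: derivative_eq_intros)
  then show ?thesis
    by (rule has_field_derivative_transform_within_open[where S = "{-M<..<M}"])
      (auto simp: eq M_def)
qed

lemma arclength_0 [simp]: "\<sigma> 0 = 0"
  by (simp add: arclength_def)

lemma arclength_1: "\<sigma> 1 = len"
  by (simp add: arclength_def curve_length_def)

lemma strict_mono_arclength: "p < q \<Longrightarrow> \<sigma> p < \<sigma> q"
  by (rule DERIV_pos_imp_increasing) (use arclength_has_derivative norm_c1_pos in blast)+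

lemma mono_arclength: "p \<le> q \<Longrightarrow> \<sigma> p \<le> \<sigma> q"
  using strict_mono_arclength[of p q] by (cases "p = q") auto

lemma length_pos: "len > 0"
  using strict_mono_arclength[of 0 1] by (simp add: arclength_1)

lemma arclength_add_1: "\<sigma> (p + 1) = \<sigma> p + len"
proof -
  have "((\<lambda>q. \<sigma> (q + 1) - \<sigma> q) has_real_derivative 0) (at q)" for q
    using DERIV_diff[OF arclength_has_derivative[of "q + 1", unfolded DERIV_shift] arclength_has_derivative[of q]]
    by (simp add: periodic1)
  then show ?thesis
    using DERIV_isconst_all[of "\<lambda>q. \<sigma> (q + 1) - \<sigma> q" p 0] by (simp add: arclength_1)
qed

lemma bij_arclength: "bij \<sigma>"
proof (rule bijI)
  show "inj \<sigma>"
    by (rule injI) (metis strict_mono_arclength less_irrefl linorder_neqE)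
  have n: "\<sigma> (real n) = real n * len \<and> \<sigma> (- real n) = - real n * len" for n
  proof (induction n)
    case (Suc n)
    show ?case using Suc arclength_add_1[of "real n"] arclength_add_1[of "- real (Suc n)"]
      by (simp add: algebra_simps)
  qed simp
  show "surj \<sigma>"
    unfolding surj_def
  proof
    fix s
    obtain n where "\<bar>s\<bar> \<le> real n * len"
      using length_pos reals_Archimedean3 by (metis less_imp_le)
    then have "\<sigma> (- real n) \<le> s" "s \<le> \<sigma> (real n)" using n[of n] by auto
    then show "\<exists>p. s = \<sigma> p"
      using IVT[of \<sigma> "- real n" s "real n"] arclength_has_derivative DERIV_isCont
      by (metis order.trans of_nat_0_le_iff neg_le_0_iff_le)
  qed
qed

lemma arclength_inv [simp]: "\<sigma> (\<rho> s) = s" "\<rho> (\<sigma> p) = p"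
  using bij_arclength by (auto simp: surj_f_inv_f bij_is_surj bij_is_inj)

lemma inv_has_derivative: "(\<rho> has_real_derivative inverse (norm (c1 (\<rho> s)))) (at s)"
proof (rule DERIV_inverse_function[where a = "s - 1" and b = "s + 1"])
  show "(\<sigma> has_real_derivative norm (c1 (\<rho> s))) (at (\<rho> s))" by (rule arclength_has_derivative)
  have "isCont \<rho> (\<sigma> (\<rho> s))"
    by (rule isCont_inverse_function[where d = 1]) (use arclength_has_derivative DERIV_isCont in auto)
  then show "isCont \<rho> s" by simp
qed (use regular in auto)

lemma cont_inv: "continuous_on S \<rho>"
  using inv_has_derivative DERIV_isCont by (blast intro: continuous_at_imp_continuous_on)

lemma param_has_vector_derivative:
  "(arclength_param c has_vector_derivative tangent (\<rho> s)) (at s)"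
  using vector_diff_chain_at[OF inv_has_derivative[unfolded has_real_derivative_iff_has_vector_derivative] deriv]
  by (simp add: arclength_param_def[abs_def] o_def tangent_def)

lemma tangent_inv_has_vector_derivative:
  "((\<lambda>s. tangent (\<rho> s)) has_vector_derivative tangent_deriv (\<rho> s) /\<^sub>R norm (c1 (\<rho> s))) (at s)"
  using vector_diff_chain_at[OF inv_has_derivative[unfolded has_real_derivative_iff_has_vector_derivative]
      tangent_has_vector_derivative]
  by (simp add: o_def)

lemma unit_normal_eq: "unit_normal c s = rot90 (tangent (\<rho> s))"
  by (simp add: unit_normal_def rot90_def Let_def vector_derivative_at[OF param_has_vector_derivative])

lemma curvature_vector_eq: "curvature_vector c s = tangent_deriv (\<rho> s) /\<^sub>R norm (c1 (\<rho> s))"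
  by (simp add: curvature_vector_def vector_derivative_at[OF param_has_vector_derivative]
     vector_derivative_at[OF tangent_inv_has_vector_derivative])

lemma curvature_eq: "curvature c s = (tangent_deriv (\<rho> s) \<bullet> rot90 (tangent (\<rho> s))) / norm (c1 (\<rho> s))"
  by (simp add: curvature_def unit_normal_eq curvature_vector_eq divide_simps)

lemma cont_curvature: "continuous_on S (curvature c)"
  unfolding curvature_eq[abs_def]
  by (intro continuous_intros continuous_on_compose2[OF cont_tangent(1)] continuous_on_compose2[OF cont_tangent(2)]
      continuous_on_compose2[OF cont_speed] cont_inv) (auto simp: regular)

lemma cont_tangent_inv: "continuous_on S (\<lambda>s. tangent (\<rho> s))"
  by (intro continuous_on_compose2[OF cont_tangent(1)] cont_inv) auto

lemma cont_normal: "continuous_on S (unit_normal c)"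
  unfolding unit_normal_eq[abs_def]
  by (intro continuous_intros cont_tangent_inv)

lemma cont_param: "continuous_on S (arclength_param c)"
  using param_has_vector_derivative has_vector_derivative_continuous
  by (blast intro: continuous_at_imp_continuous_on)

text \<open>
  The Frenet equation \<open>\<partial>\<tau> = \<kappa> \<nu>\<close> in the given parameter: a unit vector field has a derivative
  orthogonal to itself.
\<close>

lemma tangent_deriv_normal: "tangent_deriv p = (curvature c (\<sigma> p) * norm (c1 p)) *\<^sub>R rot90 (tangent p)"
proof -
  have "((\<lambda>p. tangent p \<bullet> tangent p) has_real_derivative tangent p \<bullet> tangent_deriv p + tangent_deriv p \<bullet> tangent p) (at p)"
    by (intro has_real_derivative_inner tangent_has_vector_derivative)
  moreover have "((\<lambda>p. tangent p \<bullet> tangent p) has_real_derivative 0) (at p)"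
    by (simp add: tangent_inner)
  ultimately have "tangent p \<bullet> tangent_deriv p + tangent_deriv p \<bullet> tangent p = 0"
    by (rule DERIV_unique)
  then have orth: "tangent p $ 1 * tangent_deriv p $ 1 + tangent p $ 2 * tangent_deriv p $ 2 = 0"
    by (simp add: inner_real2 inner_commute)
  have unit: "(tangent p $ 1)\<^sup>2 + (tangent p $ 2)\<^sup>2 = 1"
    using tangent_inner[of p] by (simp add: inner_real2 power2_eq_square)
  have "curvature c (\<sigma> p) * norm (c1 p) = tangent_deriv p \<bullet> rot90 (tangent p)"
    using regular[of p] by (simp add: curvature_eq)
  then have "(curvature c (\<sigma> p) * norm (c1 p)) = - tangent_deriv p $ 1 * tangent p $ 2 + tangent_deriv p $ 2 * tangent p $ 1"
    by (simp add: inner_real2)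
  then show ?thesis
    using orth unit unfolding vec_eq_iff forall_2
    unfolding vector_scaleR_component rot90_nth real_scaleR_def by algebra
qed

lemma integral_arclength:
  assumes "continuous_on UNIV (G :: real \<Rightarrow> real)"
  shows "integral {0..len} G = integral {0..1} (\<lambda>p. norm (c1 p) * G (\<sigma> p))"
proof -
  have "((\<lambda>p. norm (c1 p) *\<^sub>R G (\<sigma> p)) has_integral integral {\<sigma> 0..\<sigma> 1} G) {0..1}"
  proof (rule has_integral_substitution[where c = 0 and d = len])
    show "\<sigma> ` {0..1} \<subseteq> {0..len}"
      using mono_arclength[of 0] mono_arclength[of _ 1] by (auto simp: arclength_1)
    show "\<sigma> 0 \<le> \<sigma> 1" by (intro mono_arclength) simp
    show "continuous_on {0..len} G" using assms by (rule continuous_on_subset) simp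
    show "(\<sigma> has_real_derivative norm (c1 p)) (at p within {0..1})" for p
      using arclength_has_derivative by (rule has_field_derivative_at_within)
  qed simp
  then show ?thesis by (simp add: arclength_1 integral_unique)
qed

lemma length_eq: "len = integral {0..1} (\<lambda>p. norm (c1 p))"
  by (simp add: curve_length_def)

lemma signed_area_eq: "signed_area c = - (1 / 2) * integral {0..1} (\<lambda>p. c p \<bullet> rot90 (c1 p))"
proof -
  have "norm (c1 p) * (c p \<bullet> rot90 (tangent p)) = c p \<bullet> rot90 (c1 p)" for p
    using arg_cong[OF speed_times_tangent, of rot90 p] by (metis rot90_scaleR inner_scaleR_right)
  then show ?thesis
    unfolding signed_area_def
    by (simp add: integral_arclength[OF continuous_on_inner[OF cont_param cont_normal]])
      (simp add: arclength_param_def unit_normal_eq)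
qed

lemma curvature_times_speed: "norm (c1 p) * curvature c (\<sigma> p) = (c2 p \<bullet> rot90 (c1 p)) / (c1 p \<bullet> c1 p)"
proof -
  have "c1 p \<bullet> rot90 (c1 p) = 0" by (simp add: inner_real2)
  moreover have "norm (c1 p) * norm (c1 p) = c1 p \<bullet> c1 p" by (simp add: norm_eq_sqrt_inner)
  ultimately show ?thesis
    using regular[of p]
    by (simp add: curvature_eq tangent_deriv_def tangent_def rot90_scaleR inner_diff_left field_simps)
qed

lemma rotation_integral_eq:
  "integral {0..len} (curvature c) = integral {0..1} (\<lambda>p. (c2 p \<bullet> rot90 (c1 p)) / (c1 p \<bullet> c1 p))"
  by (simp add: integral_arclength cont_curvature curvature_times_speed)

lemma cont_curvature_deviation: "continuous_on S (curvature_deviation c)"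
  unfolding curvature_deviation_def[abs_def] by (intro continuous_intros cont_curvature)

lemma integral_curvature_deviation:
  "integral {0..len} (curvature_deviation c) = 0"
proof -
  have "((\<lambda>s. curvature c s - 1 / len * integral {0..len} (curvature c)) has_integral
      integral {0..len} (curvature c) - len * (1 / len * integral {0..len} (curvature c))) {0..len}"
    using has_integral_const_real[of "1 / len * integral {0..len} (curvature c)" 0 len] length_pos
    by (intro has_integral_diff integrable_integral integrable_continuous_real cont_curvature) simp
  then show ?thesis
    using length_pos by (simp add: curvature_deviation_def[abs_def] integral_unique)
qed

text \<open>
  Along an arc-length parametrization \<open>f\<close>, the Frenet equation gives \<open>f'' - w J f' = (\<kappa> - w) \<nu>\<close>.
  Rotation number one makes the mean curvature equal to \<open>w = 2 \<pi> / L\<close>, so \<open>\<kappa> - w\<close> is the curvature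
  deviation, and the two inequalities for periodic curves become geometric.
\<close>

lemma isoperimetric_deficit_bounds:
  assumes rot: "rotation_number c = 1"
  shows "0 \<le> len\<^sup>2 - 4 * pi * signed_area c"
    and "8 * pi\<^sup>2 * (len\<^sup>2 - 4 * pi * signed_area c) \<le> len ^ 3 * integral {0..len} (\<lambda>s. (curvature_deviation c s)\<^sup>2)"
proof -
  let ?f = "arclength_param c"
  define t k where "t s = tangent (\<rho> s)" and "k s = tangent_deriv (\<rho> s) /\<^sub>R norm (c1 (\<rho> s))" for s
  define w where "w = 2 * pi / len"
  have dev: "curvature_deviation c s = curvature c s - w" for s
    using rot length_pos by (simp add: curvature_deviation_def rotation_number_def w_def divide_simps)
  have k: "k s = curvature c s *\<^sub>R rot90 (t s)" for s
    using tangent_deriv_normal[of "\<rho> s"] regular by (simp add: k_def t_def)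
  have tt: "(t s $ 1)\<^sup>2 + (t s $ 2)\<^sup>2 = 1" for s
    using tangent_inner[of "\<rho> s"] by (simp add: t_def inner_real2 power2_eq_square)
  have d: "((\<lambda>s. ?f s $ i) has_real_derivative t s $ i) (at s)"
    and d1: "((\<lambda>s. t s $ i) has_real_derivative k s $ i) (at s)" for s i
    using bounded_linear.has_vector_derivative[OF bounded_linear_vec_nth param_has_vector_derivative]
      bounded_linear.has_vector_derivative[OF bounded_linear_vec_nth tangent_inv_has_vector_derivative]
    by (simp_all add: has_real_derivative_iff_has_vector_derivative t_def k_def)
  have ct: "continuous_on S t" for S
    unfolding t_def[abs_def] by (rule cont_tangent_inv)
  have c: "continuous_on S (\<lambda>s. t s $ i)" "continuous_on S (\<lambda>s. k s $ i)" for S i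
    unfolding k by (intro continuous_intros ct cont_curvature)+
  have "\<rho> len = 1" "\<rho> 0 = 0"
    using arclength_inv(2)[of 1] arclength_inv(2)[of 0] by (simp_all only: arclength_1 arclength_0)
  then have per: "?f len $ i = ?f 0 $ i" "t len $ i = t 0 $ i" for i
    using periodic[of 0] periodic1[of 0] by (auto simp: arclength_param_def t_def tangent_def)
  let ?P = "\<lambda>s. deficit_density w (?f s $ 1) (?f s $ 2) (t s $ 1) (t s $ 2)"
  have P: "integral {0..len} ?P = len - w * (2 * signed_area c)"
  proof -
    have "?P = (\<lambda>s. 1 + w * (?f s \<bullet> unit_normal c s))"
      using tt by (auto simp: deficit_density_def inner_real2 unit_normal_eq t_def[symmetric] algebra_simps)
    moreover have "((\<lambda>s. 1 + w * (?f s \<bullet> unit_normal c s)) has_integral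
        len + w * integral {0..len} (\<lambda>s. ?f s \<bullet> unit_normal c s)) {0..len}"
      using has_integral_const_real[of "1::real" 0 len] length_pos
      by (intro has_integral_add has_integral_mult_right integrable_integral integrable_continuous_real
         continuous_intros cont_param cont_normal) simp
    ultimately show ?thesis by (simp add: integral_unique signed_area_def)
  qed
  have P': "len * (len - w * (2 * signed_area c)) = len\<^sup>2 - 4 * pi * signed_area c"
    using length_pos by (simp add: w_def power2_eq_square field_simps)
  have "0 \<le> len - w * (2 * signed_area c)"
    unfolding P[symmetric] by (rule deficit_nonneg[OF length_pos w_def]) (intro d c per)+
  then have "0 \<le> len * (len - w * (2 * signed_area c))" using length_pos by simp
  then show "0 \<le> len\<^sup>2 - 4 * pi * signed_area c" by (simp only: P')
  have "(k s $ 1 + w * t s $ 2)\<^sup>2 + (k s $ 2 - w * t s $ 1)\<^sup>2 = (curvature_deviation c s)\<^sup>2" for s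
  proof -
    have "(k s $ 1 + w * t s $ 2)\<^sup>2 + (k s $ 2 - w * t s $ 1)\<^sup>2
        = (curvature c s - w)\<^sup>2 * ((t s $ 1)\<^sup>2 + (t s $ 2)\<^sup>2)"
      by (simp add: k power2_eq_square algebra_simps)
    then show ?thesis by (simp add: tt dev)
  qed
  then have "integral {0..len} (\<lambda>s. (k s $ 1 + w * t s $ 2)\<^sup>2 + (k s $ 2 - w * t s $ 1)\<^sup>2) =
     integral {0..len} (\<lambda>s. (curvature_deviation c s)\<^sup>2)" by simp
  moreover have "2 * w\<^sup>2 * integral {0..len} ?P \<le>
      integral {0..len} (\<lambda>s. (k s $ 1 + w * t s $ 2)\<^sup>2 + (k s $ 2 - w * t s $ 1)\<^sup>2)"
    by (rule deficit_le[OF length_pos w_def]) (intro d d1 c per)+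
  ultimately have "2 * w\<^sup>2 * (len - w * (2 * signed_area c)) \<le> integral {0..len} (\<lambda>s. (curvature_deviation c s)\<^sup>2)"
    by (simp add: P)
  then have "len ^ 3 * (2 * w\<^sup>2 * (len - w * (2 * signed_area c))) \<le> len ^ 3 * integral {0..len} (\<lambda>s. (curvature_deviation c s)\<^sup>2)"
    using length_pos by (intro mult_left_mono) auto
  moreover have "len ^ 3 * (2 * w\<^sup>2 * (len - w * (2 * signed_area c))) = 8 * pi\<^sup>2 * (len\<^sup>2 - 4 * pi * signed_area c)"
    unfolding P'[symmetric] using length_pos by (simp add: w_def power2_eq_square power3_eq_cube)
  ultimately show "8 * pi\<^sup>2 * (len\<^sup>2 - 4 * pi * signed_area c) \<le> len ^ 3 * integral {0..len} (\<lambda>s. (curvature_deviation c s)\<^sup>2)"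
    by simp
qed

end

section \<open>Partial derivatives on a closed half-plane\<close>

abbreviation time_space :: "(real \<times> real) set" where
  "time_space \<equiv> {0..} \<times> UNIV"

lemma Ck_on_imp_continuous_on: "Ck_on k S f \<Longrightarrow> continuous_on S f"
  by (cases k) (auto intro: has_derivative_continuous_on)

lemma Ck_on_time_space_partials:
  fixes F :: "real \<Rightarrow> real \<Rightarrow> 'b::real_normed_vector"
  assumes "Ck_on (Suc k) time_space (\<lambda>(t, p). F t p)"
  obtains Fp Ft where
    "\<And>t p. t \<ge> 0 \<Longrightarrow> (F t has_vector_derivative Fp t p) (at p)"
    "\<And>t p. t \<ge> 0 \<Longrightarrow> ((\<lambda>t. F t p) has_vector_derivative Ft t p) (at t within {0..})"
    "Ck_on k time_space (\<lambda>(t, p). Ft t p)" "Ck_on k time_space (\<lambda>(t, p). Fp t p)"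
proof -
  obtain F' where F': "\<And>x. x \<in> time_space \<Longrightarrow> ((\<lambda>(t, p). F t p) has_derivative F' x) (at x within time_space)"
    and Ck: "\<And>v. Ck_on k time_space (\<lambda>x. F' x v)"
    using assms by auto
  have lin: "F' x (h *\<^sub>R v) = h *\<^sub>R F' x v" if "x \<in> time_space" for x h v
    using linear_cmul[OF has_derivative_linear[OF F'[OF that]]] .
  show thesis
  proof (rule that[of "\<lambda>t p. F' (t, p) (0, 1)" "\<lambda>t p. F' (t, p) (1, 0)"])
    fix t p :: real assume t: "t \<ge> 0"
    have d: "((\<lambda>q. (\<lambda>(t, p). F t p) (t, q)) has_derivative (\<lambda>h. F' (t, p) (0, h))) (at p)"
      by (rule has_derivative_in_compose2[where t = time_space and g = "\<lambda>(t, p). F t p" and g' = F'])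
        (use F' t in \<open>auto intro!: derivative_eq_intros\<close>)
    have e: "F' (t, p) (0, h) = h *\<^sub>R F' (t, p) (0, 1)" for h
      using lin[of "(t, p)" h "(0, 1)"] t by simp
    from d show "(F t has_vector_derivative F' (t, p) (0, 1)) (at p)"
      by (simp only: has_vector_derivative_def case_prod_conv ext[of "\<lambda>h. F' (t, p) (0, h)", OF e])
    have d: "((\<lambda>r. (\<lambda>(t, p). F t p) (r, p)) has_derivative (\<lambda>h. F' (t, p) (h, 0))) (at t within {0..})"
      by (rule has_derivative_in_compose2[where t = time_space and g = "\<lambda>(t, p). F t p" and g' = F'])
        (use F' t in \<open>auto intro!: derivative_eq_intros\<close>)
    have e: "F' (t, p) (h, 0) = h *\<^sub>R F' (t, p) (1, 0)" for h
      using lin[of "(t, p)" h "(1, 0)"] t by simp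
    from d show "((\<lambda>t. F t p) has_vector_derivative F' (t, p) (1, 0)) (at t within {0..})"
      by (simp only: has_vector_derivative_def case_prod_conv ext[of "\<lambda>h. F' (t, p) (h, 0)", OF e])
  next
    have "(\<lambda>(t, p). F' (t, p) v) = (\<lambda>x. F' x v)" for v by auto
    then show "Ck_on k time_space (\<lambda>(t, p). F' (t, p) (1, 0))" "Ck_on k time_space (\<lambda>(t, p). F' (t, p) (0, 1))"
      by (simp_all only: Ck)
  qed
qed

lemma continuous_on_slice:
  assumes "continuous_on time_space (\<lambda>(t, p). G t p)" "t \<ge> 0"
  shows "continuous_on S (G t)"
proof -
  have "continuous_on S (\<lambda>p. (\<lambda>(t, p). G t p) (t, p))"
    by (rule continuous_on_compose2[OF assms(1)]) (use assms(2) in \<open>auto intro!: continuous_intros\<close>)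
  then show ?thesis by simp
qed

lemma continuous_on_time_space_subset:
  assumes "continuous_on time_space (\<lambda>(t, p). G t p)"
  shows "continuous_on ({0..} \<times> I) (\<lambda>x. G (fst x) (snd x))"
  by (rule continuous_on_subset[OF assms[unfolded case_prod_beta']]) auto

lemma vector_derivative_unique_half_line:
  fixes t :: real
  assumes "(f has_vector_derivative f') (at t within {0..})" "(f has_vector_derivative f'') (at t within {0..})" "t \<ge> 0"
  shows "f' = f''"
proof -
  have "(f has_vector_derivative f') (at t within cbox t (t + 1))" "(f has_vector_derivative f'') (at t within cbox t (t + 1))"
    using assms by (auto intro: has_vector_derivative_within_subset)
  then show ?thesis
    by (rule vector_derivative_unique_within_closed_interval[rotated 2]) auto
qed

lemma has_real_derivative_eq_on_half_line:
  fixes f g :: "real \<Rightarrow> real"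
  assumes "t \<ge> 0" "\<And>t. t \<ge> 0 \<Longrightarrow> g t = f t" "(f has_real_derivative D) (at t within {0..})"
  shows "(g has_real_derivative D) (at t within {0..})"
  using has_field_derivative_transform_within[OF assms(3), of 1 g] assms(1,2) by auto

text \<open>
  Equality of mixed partial derivatives up to the boundary \<open>t = 0\<close>, where the derivative in time
  is one-sided:
  differentiate the fundamental theorem of calculus for \<open>G t\<close> on the
  interval from \<open>a\<close> to \<open>q\<close> under the integral in \<open>t\<close>, and then the result in \<open>q\<close>.
\<close>

lemma mixed_partial_derivative:
  fixes G Gp Gt Gpt :: "real \<Rightarrow> real \<Rightarrow> 'b::euclidean_space"
  assumes Gp: "\<And>t p. t \<ge> 0 \<Longrightarrow> (G t has_vector_derivative Gp t p) (at p)"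
    and Gt: "\<And>t p. t \<ge> 0 \<Longrightarrow> ((\<lambda>t. G t p) has_vector_derivative Gt t p) (at t within {0..})"
    and Gpt: "\<And>t p. t \<ge> 0 \<Longrightarrow> ((\<lambda>t. Gp t p) has_vector_derivative Gpt t p) (at t within {0..})"
    and c: "continuous_on time_space (\<lambda>(t, p). Gp t p)" "continuous_on time_space (\<lambda>(t, p). Gpt t p)"
    and t: "t \<ge> 0"
  shows "(Gt t has_vector_derivative Gpt t p) (at p)"
proof -
  define a where "a = p - 1"
  have eq: "Gt t q = Gt t a + integral {a..q} (Gpt t)" if q: "q \<ge> a" for q
  proof -
    have FTC: "G s q - G s a = integral {a..q} (Gp s)" if "s \<ge> 0" for s
      using q Gp[OF that] has_vector_derivative_at_within
      by (intro integral_unique[symmetric] fundamental_theorem_of_calculus) blast+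
    have "((\<lambda>s. integral (cbox a q) (Gp s)) has_vector_derivative integral (cbox a q) (Gpt t)) (at t within {0..})"
    proof (rule leibniz_rule_vector_derivative)
      show "Gp s integrable_on cbox a q" if "s \<in> {0..}" for s
        using that by (intro integrable_continuous continuous_on_slice[OF c(1)]) auto
      show "continuous_on ({0..} \<times> cbox a q) (\<lambda>(x, y). Gpt x y)"
        using continuous_on_time_space_subset[OF c(2)] by (simp add: case_prod_beta')
    qed (use Gpt t in auto)
    then have "((\<lambda>s. G s q - G s a) has_vector_derivative integral {a..q} (Gpt t)) (at t within {0..})"
      using FTC t by (auto intro: has_vector_derivative_transform[rotated 2])
    moreover have "((\<lambda>s. G s q - G s a) has_vector_derivative Gt t q - Gt t a) (at t within {0..})"
      by (intro has_vector_derivative_diff Gt t)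
    ultimately have "integral {a..q} (Gpt t) = Gt t q - Gt t a"
      using vector_derivative_unique_half_line t by blast
    then show ?thesis by simp
  qed
  have "((\<lambda>q. integral {a..q} (Gpt t)) has_vector_derivative Gpt t p) (at p within {a..p + 1})"
    by (rule integral_has_vector_derivative[OF continuous_on_slice[OF c(2) t]]) (auto simp: a_def)
  then have "((\<lambda>q. integral {a..q} (Gpt t)) has_vector_derivative Gpt t p) (at p)"
    by (subst (asm) at_within_interior) (auto simp: a_def)
  then have "((\<lambda>q. Gt t a + integral {a..q} (Gpt t)) has_vector_derivative Gpt t p) (at p)"
    by (auto intro!: derivative_eq_intros)
  then show ?thesis
  proof (rule has_vector_derivative_transform_within_open[where S = "{a<..}"])
    show "Gt t a + integral {a..q} (Gpt t) = Gt t q" if "q \<in> {a<..}" for q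
      using eq[of q] that by simp
  qed (auto simp: a_def)
qed

lemma has_real_derivative_integral_family:
  fixes g g' :: "real \<Rightarrow> real \<Rightarrow> real"
  assumes "\<And>t p. t \<ge> 0 \<Longrightarrow> ((\<lambda>t. g t p) has_real_derivative g' t p) (at t within {0..})"
    and "\<And>t. t \<ge> 0 \<Longrightarrow> continuous_on {0..1} (g t)"
    and "continuous_on ({0..} \<times> {0..1}) (\<lambda>x. g' (fst x) (snd x))"
    and "t \<ge> 0"
  shows "((\<lambda>t. integral {0..1} (g t)) has_real_derivative integral {0..1} (g' t)) (at t within {0..})"
  using leibniz_rule_vector_derivative[of "{0..}" "0::real" 1 g g' t] assms
  by (auto simp: has_real_derivative_iff_has_vector_derivative case_prod_beta'
      intro: integrable_continuous_real)

section \<open>Variation formulas for families of closed curves\<close>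

locale regular_closed_curve_family =
  fixes F Fp Ft Fpp Fpt Fppt :: "real \<Rightarrow> real \<Rightarrow> real^2"
  assumes F_p: "\<And>t p. t \<ge> 0 \<Longrightarrow> (F t has_vector_derivative Fp t p) (at p)"
    and Fp_p: "\<And>t p. t \<ge> 0 \<Longrightarrow> (Fp t has_vector_derivative Fpp t p) (at p)"
    and Ft_p: "\<And>t p. t \<ge> 0 \<Longrightarrow> (Ft t has_vector_derivative Fpt t p) (at p)"
    and Fpt_p: "\<And>t p. t \<ge> 0 \<Longrightarrow> (Fpt t has_vector_derivative Fppt t p) (at p)"
    and F_t: "\<And>t p. t \<ge> 0 \<Longrightarrow> ((\<lambda>t. F t p) has_vector_derivative Ft t p) (at t within {0..})"
    and Fp_t: "\<And>t p. t \<ge> 0 \<Longrightarrow> ((\<lambda>t. Fp t p) has_vector_derivative Fpt t p) (at t within {0..})"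
    and Fpp_t: "\<And>t p. t \<ge> 0 \<Longrightarrow> ((\<lambda>t. Fpp t p) has_vector_derivative Fppt t p) (at t within {0..})"
    and cont: "continuous_on time_space (\<lambda>(t, p). F t p)" "continuous_on time_space (\<lambda>(t, p). Fp t p)"
      "continuous_on time_space (\<lambda>(t, p). Ft t p)" "continuous_on time_space (\<lambda>(t, p). Fpp t p)"
      "continuous_on time_space (\<lambda>(t, p). Fpt t p)" "continuous_on time_space (\<lambda>(t, p). Fppt t p)"
    and periodic: "\<And>t p. t \<ge> 0 \<Longrightarrow> F t (p + 1) = F t p"
    and regular: "\<And>t p. t \<ge> 0 \<Longrightarrow> Fp t p \<noteq> 0"
begin

lemma slice: "t \<ge> 0 \<Longrightarrow> regular_closed_curve (F t) (Fp t) (Fpp t)"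
  by unfold_locales (auto intro: F_p Fp_p periodic continuous_on_slice[OF cont(4)] dest: regular)

lemmas cont_slice = cont[THEN continuous_on_slice]
lemmas cont_joint = cont[THEN continuous_on_time_space_subset]

lemma periodic_time: "t \<ge> 0 \<Longrightarrow> Ft t (p + 1) = Ft t p"
proof -
  assume t: "t \<ge> 0"
  have "((\<lambda>t. F t (p + 1)) has_vector_derivative Ft t p) (at t within {0..})"
    by (rule has_vector_derivative_transform[OF _ _ F_t]) (auto simp: t periodic)
  with F_t[OF t] show ?thesis using vector_derivative_unique_half_line t by blast
qed

lemma periodic_mixed: 
  assumes t: "t \<ge> 0" shows "Fpt t (p + 1) = Fpt t p"
proof -
  have "((\<lambda>q. q + 1) has_vector_derivative 1) (at p)"
    by (auto intro!: derivative_eq_intros)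
  from vector_diff_chain_at[OF this Ft_p[OF t]]
  have "((\<lambda>q. Ft t (q + 1)) has_vector_derivative Fpt t (p + 1)) (at p)"
    by (simp add: o_def)
  then show ?thesis using Ft_p[OF t, of p] t by (simp add: periodic_time vector_derivative_unique_at)
qed

text \<open>
  The first variation of length, \<open>- \<integral> \<langle>\<partial>\<tau>, V\<rangle>\<close> for a velocity field \<open>V\<close>. Integrating by parts
  moves the derivative from \<open>V\<close> to the tangent, so the curvature is never differentiated when
  \<open>V\<close> is a curvature flow.
\<close>

lemma length_variation:
  assumes t: "t \<ge> 0"
  shows "((\<lambda>t. curve_length (F t)) has_real_derivative
    - integral {0..1} (\<lambda>p. regular_closed_curve.tangent_deriv (Fp t) (Fpp t) p \<bullet> Ft t p)) (at t within {0..})"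
proof -
  interpret c: regular_closed_curve "F t" "Fp t" "Fpp t" using t by (rule slice)
  let ?D = "\<lambda>t p. (Fp t p \<bullet> Fpt t p) / norm (Fp t p)"
  have "((\<lambda>t. integral {0..1} (\<lambda>p. norm (Fp t p))) has_real_derivative integral {0..1} (?D t)) (at t within {0..})"
    by (intro has_real_derivative_integral_family has_real_derivative_norm Fp_t regular continuous_intros
       cont_slice cont_joint t) (auto simp: regular)
  then have 1: "((\<lambda>t. curve_length (F t)) has_real_derivative integral {0..1} (?D t)) (at t within {0..})"
    by (rule has_real_derivative_eq_on_half_line[rotated 2])
      (use t regular_closed_curve.length_eq[OF slice] in auto)
  have D: "?D t p = c.tangent p \<bullet> Fpt t p" for p
    by (simp add: c.tangent_def divide_simps)
  have "((\<lambda>p. c.tangent p \<bullet> Ft t p) has_real_derivative c.tangent p \<bullet> Fpt t p + c.tangent_deriv p \<bullet> Ft t p) (at p)" for p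
    by (intro has_real_derivative_inner c.tangent_has_vector_derivative Ft_p t)
  then have "((\<lambda>p. c.tangent p \<bullet> Fpt t p + c.tangent_deriv p \<bullet> Ft t p) has_integral
      (c.tangent 1 \<bullet> Ft t 1 - c.tangent 0 \<bullet> Ft t 0)) {0..1}"
    by (intro has_integral_of_DERIV) auto
  moreover have "c.tangent 1 = c.tangent 0" "Ft t 1 = Ft t 0"
    using c.periodic1[of 0] periodic_time[OF t, of 0] by (auto simp: c.tangent_def)
  ultimately have 2: "((\<lambda>p. c.tangent p \<bullet> Fpt t p + c.tangent_deriv p \<bullet> Ft t p) has_integral 0) {0..1}"
    by simp
  have "(\<lambda>p. c.tangent_deriv p \<bullet> Ft t p) integrable_on {0..1}"
    by (intro integrable_continuous_real continuous_intros c.cont_tangent cont_slice t)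
  from has_integral_diff[OF 2 integrable_integral[OF this]]
  have "integral {0..1} (?D t) = - integral {0..1} (\<lambda>p. c.tangent_deriv p \<bullet> Ft t p)"
    by (simp add: D integral_unique)
  with 1 show ?thesis by simp
qed

lemma area_variation:
  assumes t: "t \<ge> 0"
  shows "((\<lambda>t. signed_area (F t)) has_real_derivative
    - integral {0..1} (\<lambda>p. Ft t p \<bullet> rot90 (Fp t p))) (at t within {0..})"
proof -
  let ?D = "\<lambda>t p. F t p \<bullet> rot90 (Fpt t p) + Ft t p \<bullet> rot90 (Fp t p)"
  let ?I = "integral {0..1} (\<lambda>p. Ft t p \<bullet> rot90 (Fp t p))"
  have "((\<lambda>t. integral {0..1} (\<lambda>p. F t p \<bullet> rot90 (Fp t p))) has_real_derivative integral {0..1} (?D t)) (at t within {0..})"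
    by (intro has_real_derivative_integral_family has_real_derivative_inner has_vector_derivative_rot90 F_t Fp_t
       continuous_intros cont_slice cont_joint t) 
  then have "((\<lambda>t. - (1 / 2) * integral {0..1} (\<lambda>p. F t p \<bullet> rot90 (Fp t p))) has_real_derivative
      - (1 / 2) * integral {0..1} (?D t)) (at t within {0..})"
    by (rule DERIV_cmult)
  then have 1: "((\<lambda>t. signed_area (F t)) has_real_derivative - (1 / 2) * integral {0..1} (?D t)) (at t within {0..})"
    by (rule has_real_derivative_eq_on_half_line[rotated 2])
      (use t regular_closed_curve.signed_area_eq[OF slice] in auto)
  have "((\<lambda>p. F t p \<bullet> rot90 (Ft t p)) has_real_derivative F t p \<bullet> rot90 (Fpt t p) + Fp t p \<bullet> rot90 (Ft t p)) (at p)" for p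
    by (intro has_real_derivative_inner has_vector_derivative_rot90 F_p Ft_p t)
  then have "((\<lambda>p. F t p \<bullet> rot90 (Fpt t p) + Fp t p \<bullet> rot90 (Ft t p)) has_integral
      (F t 1 \<bullet> rot90 (Ft t 1) - F t 0 \<bullet> rot90 (Ft t 0))) {0..1}"
    by (intro has_integral_of_DERIV) auto
  moreover have "F t 1 = F t 0" "Ft t 1 = Ft t 0"
    using periodic[OF t, of 0] periodic_time[OF t, of 0] by auto
  moreover have "Fp t p \<bullet> rot90 (Ft t p) = - (Ft t p \<bullet> rot90 (Fp t p))" for p
    by (simp add: inner_real2)
  ultimately have 2: "((\<lambda>p. F t p \<bullet> rot90 (Fpt t p) - Ft t p \<bullet> rot90 (Fp t p)) has_integral 0) {0..1}"
    by simp
  have "(\<lambda>p. Ft t p \<bullet> rot90 (Fp t p)) integrable_on {0..1}"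
    by (intro integrable_continuous_real continuous_intros cont_slice t)
  from has_integral_add[OF 2 has_integral_mult_right[OF integrable_integral[OF this], of 2]]
  have "integral {0..1} (?D t) = 2 * ?I"
    by (simp add: algebra_simps integral_unique)
  with 1 show ?thesis by simp
qed

text \<open>
  With \<open>\<theta>\<close> the angle of the tangent, the rotation number integrates
  \<open>\<partial>\<^sub>p \<theta> = \<langle>Fpp, J Fp\<rangle> / \<bar>Fp\<bar>\<^sup>2\<close>, and its time derivative integrates
  \<open>\<partial>\<^sub>t \<partial>\<^sub>p \<theta> = \<partial>\<^sub>p \<partial>\<^sub>t \<theta>\<close>, which is the derivative of the periodic function
  \<open>\<langle>Fpt, J Fp\<rangle> / \<bar>Fp\<bar>\<^sup>2\<close>. The angle itself, which need not be periodic, is never formed.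
\<close>

lemma rotation_variation:
  assumes t: "t \<ge> 0"
  shows "((\<lambda>t. rotation_number (F t)) has_real_derivative 0) (at t within {0..})"
proof -
  let ?q = "\<lambda>t p. Fp t p \<bullet> Fp t p"
  let ?D = "\<lambda>t p. ((Fpp t p \<bullet> rot90 (Fpt t p) + Fppt t p \<bullet> rot90 (Fp t p)) * ?q t p
    - (Fpp t p \<bullet> rot90 (Fp t p)) * (Fp t p \<bullet> Fpt t p + Fpt t p \<bullet> Fp t p)) / (?q t p * ?q t p)"
  have "((\<lambda>t. integral {0..1} (\<lambda>p. (Fpp t p \<bullet> rot90 (Fp t p)) / ?q t p)) has_real_derivative
      integral {0..1} (?D t)) (at t within {0..})"
    by (intro has_real_derivative_integral_family DERIV_divide has_real_derivative_inner has_vector_derivative_rot90 Fp_t Fpp_t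
       continuous_intros cont_slice cont_joint t) (auto simp: regular)
  then have "((\<lambda>t. 1 / (2 * pi) * integral {0..1} (\<lambda>p. (Fpp t p \<bullet> rot90 (Fp t p)) / ?q t p)) has_real_derivative
      1 / (2 * pi) * integral {0..1} (?D t)) (at t within {0..})"
    by (rule DERIV_cmult)
  then have 1: "((\<lambda>t. rotation_number (F t)) has_real_derivative 1 / (2 * pi) * integral {0..1} (?D t)) (at t within {0..})"
    by (rule has_real_derivative_eq_on_half_line[rotated 2])
      (use t regular_closed_curve.rotation_integral_eq[OF slice] in \<open>auto simp: rotation_number_def\<close>)
  let ?E = "\<lambda>p. (Fpt t p \<bullet> rot90 (Fp t p)) / ?q t p"
  have "(?E has_real_derivative ?D t p) (at p)" for p
  proof -
    have "(?E has_real_derivative ((Fpt t p \<bullet> rot90 (Fpp t p) + Fppt t p \<bullet> rot90 (Fp t p)) * ?q t p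
        - (Fpt t p \<bullet> rot90 (Fp t p)) * (Fp t p \<bullet> Fpp t p + Fpp t p \<bullet> Fp t p)) / (?q t p * ?q t p)) (at p)"
      by (intro DERIV_divide has_real_derivative_inner has_vector_derivative_rot90 Fp_p Fpt_p t) (simp add: regular t)
    also have "(Fpt t p \<bullet> rot90 (Fpp t p) + Fppt t p \<bullet> rot90 (Fp t p)) * ?q t p
        - (Fpt t p \<bullet> rot90 (Fp t p)) * (Fp t p \<bullet> Fpp t p + Fpp t p \<bullet> Fp t p)
      = (Fpp t p \<bullet> rot90 (Fpt t p) + Fppt t p \<bullet> rot90 (Fp t p)) * ?q t p
        - (Fpp t p \<bullet> rot90 (Fp t p)) * (Fp t p \<bullet> Fpt t p + Fpt t p \<bullet> Fp t p)"
      unfolding inner_real2 rot90_nth by algebra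
    finally show ?thesis .
  qed
  then have "(?D t has_integral (?E 1 - ?E 0)) {0..1}"
    by (intro has_integral_of_DERIV) auto
  moreover have "?E 1 = ?E 0"
    using regular_closed_curve.periodic1[OF slice[OF t], of 0] periodic_mixed[OF t, of 0] by simp
  ultimately have "integral {0..1} (?D t) = 0" by (simp add: integral_unique)
  with 1 show ?thesis by simp
qed

end

section \<open>The area-preserving curvature flow\<close>

lemma greaterThan_subset_atLeast: "{a<..} \<subseteq> {a::real..}"
  by auto

lemma nonincreasing_on_half_line:
  fixes f f' :: "real \<Rightarrow> real"
  assumes f: "\<And>t. t \<ge> 0 \<Longrightarrow> (f has_real_derivative f' t) (at t within {0..})"
    and f': "\<And>t. t \<ge> 0 \<Longrightarrow> f' t \<le> 0" and t: "t \<ge> 0"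
  shows "f t \<le> f 0"
proof (rule DERIV_nonpos_imp_decreasing_open[OF t])
  show "\<exists>y. (f has_real_derivative y) (at x) \<and> y \<le> 0" if "0 < x" "x < t" for x
  proof -
    have "(f has_real_derivative f' x) (at x)"
      using DERIV_subset[OF f[of x] greaterThan_subset_atLeast] at_within_open[of x "{0<..}"] that by auto
    then show ?thesis using f'[of x] that by auto
  qed
  have "continuous_on {0..} f" using f by (auto intro: DERIV_continuous_on)
  then show "continuous_on {0..t} f" by (rule continuous_on_subset) auto
qed

locale area_preserving_curvature_flow = regular_closed_curve_family +
  assumes velocity: "\<And>t p. t \<ge> 0 \<Longrightarrow>
      Ft t p = curvature_deviation (F t) (arclength (F t) p) *\<^sub>R unit_normal (F t) (arclength (F t) p)"
begin

lemma area_constant: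
  assumes "t \<ge> 0"
  shows "signed_area (F t) = signed_area (F 0)"
proof -
  have "((\<lambda>t. signed_area (F t)) has_real_derivative 0) (at t within {0..})" if t: "t \<ge> 0" for t
  proof -
    interpret c: regular_closed_curve "F t" "Fp t" "Fpp t" using t by (rule slice)
    have "Ft t p \<bullet> rot90 (Fp t p) = norm (Fp t p) * curvature_deviation (F t) (c.\<sigma> p)" for p
    proof -
      have "rot90 (Fp t p) = norm (Fp t p) *\<^sub>R rot90 (c.tangent p)"
        using c.speed_times_tangent[of p] rot90_scaleR by metis
      moreover have "rot90 (c.tangent p) \<bullet> rot90 (c.tangent p) = 1"
        using c.tangent_inner[of p] by (simp add: inner_real2 add.commute)
      ultimately show ?thesis using t by (simp add: velocity c.unit_normal_eq)
    qed
    then have "integral {0..1} (\<lambda>p. Ft t p \<bullet> rot90 (Fp t p)) = integral {0..c.len} (curvature_deviation (F t))"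
      by (simp add: c.integral_arclength c.cont_curvature_deviation)
    also have "\<dots> = 0" by (rule c.integral_curvature_deviation)
    finally show ?thesis using area_variation[OF t] by simp
  qed
  then have "\<exists>k. \<forall>t\<in>{0..}. signed_area (F t) = k"
    by (intro has_field_derivative_zero_constant) auto
  then show ?thesis using assms by force
qed

lemma rotation_number_constant:
  assumes "t \<ge> 0"
  shows "rotation_number (F t) = rotation_number (F 0)"
proof -
  have "\<exists>k. \<forall>t\<in>{0..}. rotation_number (F t) = k"
    using rotation_variation by (intro has_field_derivative_zero_constant) auto
  then show ?thesis using assms by force
qed

text \<open>
  The first variation is \<open>- \<integral> \<kappa> \<kappa>~\<close> with \<open>\<kappa>~\<close> the curvature deviation. As \<open>\<kappa>~\<close> has mean zero,
  the constant \<open>\<kappa> - \<kappa>~\<close> does not contribute.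
\<close>

lemma length_derivative:
  assumes t: "t \<ge> 0"
  shows "((\<lambda>t. curve_length (F t)) has_real_derivative
    - integral {0..curve_length (F t)} (\<lambda>s. (curvature_deviation (F t) s)\<^sup>2)) (at t within {0..})"
proof -
  interpret c: regular_closed_curve "F t" "Fp t" "Fpp t" using t by (rule slice)
  have "c.tangent_deriv p \<bullet> Ft t p = norm (Fp t p) * (curvature (F t) (c.\<sigma> p) * curvature_deviation (F t) (c.\<sigma> p))" for p
  proof -
    have "rot90 (c.tangent p) \<bullet> rot90 (c.tangent p) = 1"
      using c.tangent_inner[of p] by (simp add: inner_real2 add.commute)
    then show ?thesis using t by (simp add: velocity c.unit_normal_eq c.tangent_deriv_normal)
  qed
  then have "integral {0..1} (\<lambda>p. c.tangent_deriv p \<bullet> Ft t p) =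
      integral {0..c.len} (\<lambda>s. curvature (F t) s * curvature_deviation (F t) s)"
    by (subst c.integral_arclength) (auto intro!: continuous_intros c.cont_curvature c.cont_curvature_deviation)
  also have "\<dots> = integral {0..c.len} (\<lambda>s. (curvature_deviation (F t) s)\<^sup>2)"
  proof -
    define m where "m = 1 / c.len * integral {0..c.len} (curvature (F t))"
    have k: "curvature (F t) s = curvature_deviation (F t) s + m" for s
      by (simp add: curvature_deviation_def m_def)
    have "((\<lambda>s. (curvature_deviation (F t) s)\<^sup>2 + m * curvature_deviation (F t) s) has_integral
       integral {0..c.len} (\<lambda>s. (curvature_deviation (F t) s)\<^sup>2) + m * integral {0..c.len} (curvature_deviation (F t))) {0..c.len}"
      by (intro has_integral_add has_integral_mult_right integrable_integral integrable_continuous_real continuous_intros c.cont_curvature_deviation)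
    then show ?thesis
      by (simp add: k c.integral_curvature_deviation integral_unique power2_eq_square algebra_simps)
  qed
  finally show ?thesis using length_variation[OF t] by simp
qed

end

text \<open>
  Three orders of differentiability suffice. The smoothness of the flow provides the time
  derivatives of \<open>F\<close>, \<open>Fp\<close> and \<open>Fpp\<close>; symmetry of mixed partial derivatives identifies the last two
  with the space derivatives of \<open>Ft\<close> and \<open>Fpt\<close>.
\<close>

lemma global_flow_partials:
  assumes "global_area_preserving_flow F"
  obtains Fp Ft Fpp Fpt Fppt where "area_preserving_curvature_flow F Fp Ft Fpp Fpt Fppt"
proof -
  have sm: "Ck_on (Suc (Suc (Suc 0))) time_space (\<lambda>(t, p). F t p)"
    and imm: "\<And>t. t \<ge> 0 \<Longrightarrow> immersed_closed (F t)"
    and vel: "\<And>t p. t \<ge> 0 \<Longrightarrow> ((\<lambda>t'. F t' p) has_vector_derivative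
        curvature_deviation (F t) (arclength (F t) p) *\<^sub>R unit_normal (F t) (arclength (F t) p)) (at t within {0..})"
    using assms unfolding global_area_preserving_flow_def smooth_on_def by blast+
  obtain Fp Ft where F: "\<And>t p. t \<ge> 0 \<Longrightarrow> (F t has_vector_derivative Fp t p) (at p)"
    "\<And>t p. t \<ge> 0 \<Longrightarrow> ((\<lambda>t. F t p) has_vector_derivative Ft t p) (at t within {0..})"
    "Ck_on (Suc (Suc 0)) time_space (\<lambda>(t, p). Ft t p)" "Ck_on (Suc (Suc 0)) time_space (\<lambda>(t, p). Fp t p)"
    by (rule Ck_on_time_space_partials[OF sm]) (rule that)
  obtain Fpp Fpt where Fp: "\<And>t p. t \<ge> 0 \<Longrightarrow> (Fp t has_vector_derivative Fpp t p) (at p)"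
    "\<And>t p. t \<ge> 0 \<Longrightarrow> ((\<lambda>t. Fp t p) has_vector_derivative Fpt t p) (at t within {0..})"
    "Ck_on (Suc 0) time_space (\<lambda>(t, p). Fpt t p)" "Ck_on (Suc 0) time_space (\<lambda>(t, p). Fpp t p)"
    by (rule Ck_on_time_space_partials[OF F(4)]) (rule that)
  obtain Fppp Fppt where Fpp: "\<And>t p. t \<ge> 0 \<Longrightarrow> (Fpp t has_vector_derivative Fppp t p) (at p)"
    "\<And>t p. t \<ge> 0 \<Longrightarrow> ((\<lambda>t. Fpp t p) has_vector_derivative Fppt t p) (at t within {0..})"
    "Ck_on 0 time_space (\<lambda>(t, p). Fppt t p)" "Ck_on 0 time_space (\<lambda>(t, p). Fppp t p)"
    by (rule Ck_on_time_space_partials[OF Fp(4)]) (rule that)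
  note c = Ck_on_imp_continuous_on[OF sm] F(3,4)[THEN Ck_on_imp_continuous_on]
    Fp(3,4)[THEN Ck_on_imp_continuous_on] Fpp(3)[THEN Ck_on_imp_continuous_on]
  have "area_preserving_curvature_flow F Fp Ft Fpp Fpt Fppt"
  proof
    fix t p :: real assume t: "t \<ge> 0"
    show "(Ft t has_vector_derivative Fpt t p) (at p)"
      by (rule mixed_partial_derivative[OF F(1,2) Fp(2) c(3,4) t])
    show "(Fpt t has_vector_derivative Fppt t p) (at p)"
      by (rule mixed_partial_derivative[OF Fp(1,2) Fpp(2) c(5,6) t])
    show "F t (p + 1) = F t p" using imm[OF t] by (simp add: immersed_closed_def)
    show "Fp t p \<noteq> 0"
      using imm[OF t] vector_derivative_at[OF F(1)[OF t, of p]] by (auto simp: immersed_closed_def)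
    show "Ft t p = curvature_deviation (F t) (arclength (F t) p) *\<^sub>R unit_normal (F t) (arclength (F t) p)"
      by (rule vector_derivative_unique_half_line[OF F(2) vel]) (use t in auto)
  qed (use F Fp Fpp c in auto)
  then show thesis by (rule that)
qed

theorem theorem4p4:
  fixes F :: "real \<Rightarrow> real \<Rightarrow> real^2" and L A :: "real \<Rightarrow> real"
  defines "L \<equiv> \<lambda>t. curve_length (F t)"
    and "A \<equiv> \<lambda>t. signed_area (F t)"
  assumes "global_area_preserving_flow F"
    and "rotation_number (F 0) = 1"
  shows "\<forall>t\<ge>0.
    0 \<le> (L t)\<^sup>2 - 4 * pi * A t \<and>
    (L t)\<^sup>2 - 4 * pi * A t \<le> ((L 0)\<^sup>2 - 4 * pi * A 0) * exp (- (16 * pi\<^sup>2 / (L 0)\<^sup>2) * t) \<and>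
    \<bar>L t - 2 * sqrt (pi * A 0)\<bar>
      \<le> ((L 0)\<^sup>2 - 4 * pi * A 0) / (4 * sqrt (pi * A 0)) * exp (- (16 * pi\<^sup>2 / (L 0)\<^sup>2) * t)"
proof -
  obtain Fp Ft Fpp Fpt Fppt where "area_preserving_curvature_flow F Fp Ft Fpp Fpt Fppt"
    using global_flow_partials[OF assms(3)] .
  then interpret area_preserving_curvature_flow F Fp Ft Fpp Fpt Fppt .
  define K where "K t = integral {0..L t} (\<lambda>s. (curvature_deviation (F t) s)\<^sup>2)" for t
  define D where "D t = (L t)\<^sup>2 - 4 * pi * A t" for t
  define a where "a = 16 * pi\<^sup>2 / (L 0)\<^sup>2"
  have Lpos: "L t > 0" if "t \<ge> 0" for t
    using regular_closed_curve.length_pos[OF slice[OF that]] by (simp add: L_def)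
  have A: "A t = A 0" if "t \<ge> 0" for t using area_constant[OF that] by (simp add: A_def)
  have rot: "rotation_number (F t) = 1" if "t \<ge> 0" for t
    using rotation_number_constant[OF that] assms(4) by simp
  have D0: "D t \<ge> 0" and DK: "8 * pi\<^sup>2 * D t \<le> L t ^ 3 * K t" if "t \<ge> 0" for t
    using regular_closed_curve.isoperimetric_deficit_bounds[OF slice[OF that] rot[OF that]]
    by (simp_all add: D_def L_def A_def K_def)
  have L': "(L has_real_derivative - K t) (at t within {0..})" if "t \<ge> 0" for t
    using length_derivative[OF that] by (simp add: L_def K_def)
  have D': "(D has_real_derivative - 2 * L t * K t) (at t within {0..})" if "t \<ge> 0" for t
  proof -
    have "D s = (L s)\<^sup>2 - 4 * pi * A 0" if "s \<ge> 0" for s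
      using A[OF that] by (simp add: D_def)
    moreover have "((\<lambda>t. (L t)\<^sup>2 - 4 * pi * A 0) has_real_derivative - 2 * L t * K t) (at t within {0..})"
      by (auto intro!: derivative_eq_intros L' that)
    ultimately show ?thesis
      by (rule has_real_derivative_eq_on_half_line[OF that])
  qed
  have rate: "2 * L t * K t \<ge> 16 * pi\<^sup>2 * (D t / (L t)\<^sup>2)" if "t \<ge> 0" for t
    using DK[OF that] Lpos[OF that] by (simp add: field_simps power2_eq_square power3_eq_cube)
  have K0: "K t \<ge> 0" if "t \<ge> 0" for t
    unfolding K_def
    by (cases "(\<lambda>s. (curvature_deviation (F t) s)\<^sup>2) integrable_on {0..L t}")
      (simp_all add: integral_nonneg not_integrable_integral)
  have L_le: "L t \<le> L 0" if "t \<ge> 0" for t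
    using nonincreasing_on_half_line[OF L' _ that] K0 by force
  have decay: "D t \<le> D 0 * exp (- a * t)" if t: "t \<ge> 0" for t
  proof -
    have "D t * exp (a * t) \<le> D 0 * exp (a * 0)"
    proof (rule nonincreasing_on_half_line[OF _ _ t])
      fix s :: real assume s: "s \<ge> 0"
      show "((\<lambda>s. D s * exp (a * s)) has_real_derivative (a * D s - 2 * L s * K s) * exp (a * s)) (at s within {0..})"
        by (auto intro!: derivative_eq_intros D' s simp: algebra_simps)
      have "a * D s \<le> 16 * pi\<^sup>2 * (D s / (L s)\<^sup>2)"
        using D0[OF s] L_le[OF s] Lpos[OF s] Lpos[of 0]
        by (auto simp: a_def intro!: divide_left_mono mult_left_mono power_mono)
      then show "(a * D s - 2 * L s * K s) * exp (a * s) \<le> 0"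
        using rate[OF s] by (simp add: mult_nonpos_nonneg)
    qed
    then show ?thesis by (simp add: exp_minus field_simps)
  qed
  \<comment> \<open>If the area were not positive, then \<open>D \<ge> L\<^sup>2\<close>, and \<open>D\<close> would decrease at least at the fixed rate
    \<open>16 \<pi>\<^sup>2\<close> and become negative in finite time.\<close>
  have A0: "A 0 > 0"
  proof (rule ccontr)
    assume "\<not> A 0 > 0"
    then have A0: "A 0 \<le> 0" by simp
    \<comment> \<open>at this time the linear bound on \<open>D\<close> has dropped to \<open>- 1\<close>\<close>
    define T where "T = (D 0 + 1) / (16 * pi\<^sup>2)"
    have T: "T \<ge> 0" using D0[of 0] by (simp add: T_def)
    have "D T + 16 * pi\<^sup>2 * T \<le> D 0 + 16 * pi\<^sup>2 * 0"
    proof (rule nonincreasing_on_half_line[OF _ _ T])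
      fix s :: real assume s: "s \<ge> 0"
      show "((\<lambda>s. D s + 16 * pi\<^sup>2 * s) has_real_derivative 16 * pi\<^sup>2 - 2 * L s * K s) (at s within {0..})"
        by (auto intro!: derivative_eq_intros D' s)
      have "D s \<ge> (L s)\<^sup>2" using A0 A[OF s] by (simp add: D_def mult_nonneg_nonpos)
      then have "D s / (L s)\<^sup>2 \<ge> 1" using Lpos[OF s] by simp
      then have "16 * pi\<^sup>2 * (D s / (L s)\<^sup>2) \<ge> 16 * pi\<^sup>2 * 1" by (intro mult_left_mono) auto
      then show "16 * pi\<^sup>2 - 2 * L s * K s \<le> 0" using rate[OF s] by linarith
    qed
    then have "D T \<le> - 1" by (simp add: T_def)
    then show False using D0[OF T] by simp
  qed
  have length_bound: "\<bar>L t - 2 * sqrt (pi * A 0)\<bar> \<le> D 0 / (4 * sqrt (pi * A 0)) * exp (- a * t)" if t: "t \<ge> 0" for t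
  proof -
    define r where "r = 2 * sqrt (pi * A 0)"
    have r: "r > 0" "r\<^sup>2 = 4 * pi * A 0" using A0 by (simp_all add: r_def power_mult_distrib)
    have D: "D t = (L t - r) * (L t + r)"
      using A[OF t] r by (simp add: D_def power2_eq_square algebra_simps)
    have Lr: "L t \<ge> r"
      using D0[OF t] Lpos[OF t] r(1) unfolding D by (simp add: zero_le_mult_iff)
    have "(L t - r) * (2 * r) \<le> D t"
      unfolding D using Lr by (intro mult_left_mono) auto
    also have "\<dots> \<le> D 0 * exp (- a * t)" by (rule decay[OF t])
    finally have "L t - r \<le> D 0 * exp (- a * t) / (2 * r)"
      using r(1) by (simp add: pos_le_divide_eq)
    then show ?thesis using Lr by (simp add: r_def)
  qed
  show ?thesis
    using D0 decay length_bound by (simp add: D_def a_def)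
qed

end
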